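(* Consider the system $x(k+1)=A(k)x(k)+B(k)u(k)$, $x(0)=x_0\in\mathbb{R}^n$, composed of $N$ subsystems with the random matrices $A(k)$ satisfying the independence assumptions in the context. Suppose that for all $k$: $\mathbb{E}\{A(k)\}=\bar A\in\mathbb{R}^{n\times n}$, $\mathbb{E}\{A(k)\otimes A(k)\}=\Sigma\in\mathbb{R}^{n^2\times n^2}$, and $B(k)=B=\mathrm{diag}(B_{11},\dots,B_{NN})\in\mathbb{R}^{n\times m}$, with $\bar A,\Sigma,B$ independent of $k$. Suppose all subsystems are fully actuated, i.e., $m_i=n_i$, $B_{ii}\in\mathbb{R}^{n_i\times n_i}$, and there is $\epsilon>0$ with $\underline{\sigma}(B_{ii})\ge\epsilon$ for all $1\le i\le N$, where $\underline{\sigma}(\cdot)$ denotes the smallest singular value. Suppose further that the system is mean square stabilizable under limited model information (defined in the context). Let the cost be $$J_\infty(x_0,\{u(k)\}_{k=0}^\infty)=\lim_{T\to\infty}\mathbb{E}\Big\{\sum_{k=0}^{T-1}\big(x(k)^\top x(k)+u(k)^\top u(k)\big)\Big\}.$$ Let $u^{\mathrm{LMI}}$ and $u^{\mathrm{FMI}}$ be the optimal controllers for $J_\infty$ with limited and with full model information, respectively (given explicitly in the context). Then the performance degradation ratio $$r=\sup_{0\neq x_0\in\mathbb{R}^n}\frac{J_\infty(x_0,\{u^{\mathrm{LMI}}(k)\}_{k=0}^\infty)}{J_\infty(x_0,\{u^{\mathrm{FMI}}(k)\}_{k=0}^\infty)}$$ satisfies $r\le 1+1/\epsilon^2$.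
   Context: Notation: $\mathcal{S}_{+}^n$ ($\mathcal{S}_{++}^n$) is the set of symmetric positive semidefinite (positive definite) matrices in $\mathbb{R}^{n\times n}$; $\otimes$ is the Kronecker product. The discrete Riccati operator is $\mathbf{R}(A,P,B,R)=A^\top(P-PB(R+B^\top PB)^{-1}B^\top P)A$ for $A\in\mathbb{R}^{n\times n}$, $P\in\mathcal{S}_+^n$, $B\in\mathbb{R}^{n\times m}$, $R\in\mathcal{S}_{++}^m$ (for any positive integers $n,m$). System: there are $N$ subsystems, subsystem $i$ having state $x_i(k)\in\mathbb{R}^{n_i}$, input $u_i(k)\in\mathbb{R}^{m_i}$ and dynamics $x_i(k+1)=\sum_{j=1}^N A_{ij}(k)x_j(k)+B_{ii}(k)u_i(k)$. Put $n=\sum_i n_i$, $m=\sum_i m_i$, $x(k)=[x_1(k)^\top\cdots x_N(k)^\top]^\top$, $u(k)=[u_1(k)^\top\cdots u_N(k)^\top]^\top$; then $x(k+1)=A(k)x(k)+B(k)u(k)$, with $A(k)=[A_{ij}(k)]_{i,j}$ and $B(k)=\mathrm{diag}(B_{11}(k),\dots,B_{NN}(k))$. The matrices $B_{ii}(k)$ and the initial state $x_0$ are deterministic; the $A_{ij}(k)\in\mathbb{R}^{n_i\times n_j}$ are random with finite first and second moments. Independence assumptions: the block rows $[A_{i1}(k)\;\cdots\;A_{iN}(k)]$, $1\le i\le N$, $k\ge0$, are mutually independent, both in time $k$ and across subsystems $i$ (blocks within the same block row at the same time may be dependent). Write $\tilde A_{ij}(k)=A_{ij}(k)-\mathbb{E}\{A_{ij}(k)\}$.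 $B_i\in\mathbb{R}^{n\times m_i}$ is the $i$-th block column of $B$ (its $i$-th block is $B_{ii}$, all other blocks are zero). $\tilde A_i(k)\in\mathbb{R}^{n\times n}$ has $i$-th block row $[\tilde A_{i1}(k)\;\cdots\;\tilde A_{iN}(k)]$ and all other block rows zero. Information patterns: control laws with limited model information are those of the form $u_i(k)=\psi_i(A_{i1}(k),\dots,A_{iN}(k);x(0),\dots,x(k))$, $1\le i\le N$, and control laws with full model information are those of the form $u_i(k)=\psi_i(A(k);x(0),\dots,x(k))$, $1\le i\le N$, with $\psi_i$ (possibly depending on $k$) arbitrary measurable mappings into $\mathbb{R}^{m_i}$. The optimal controller with limited model information (the minimizer of $J_\infty$ over control laws with limited model information) is $$u^{\mathrm{LMI}}(k)=-(I+B^\top P^{\mathrm{LMI}}B)^{-1}B^\top P^{\mathrm{LMI}}\bar Ax(k)-\begin{bmatrix}(I+B_1^\top P^{\mathrm{LMI}}B_1)^{-1}B_1^\top P^{\mathrm{LMI}}\tilde A_1(k)\\ \vdots\\ (I+B_N^\top P^{\mathrm{LMI}}B_N)^{-1}B_N^\top P^{\mathrm{LMI}}\tilde A_N(k)\end{bmatrix}x(k),$$ where $P^{\mathrm{LMI}}$ is the unique positive-definite solution of $P=I+\mathbf{R}(\bar A,P,B,I)+\sum_{i=1}^N\mathbb{E}\{\mathbf{R}(\tilde A_i(k),P,B_i,I)\}$. The optimal controller with full model information (the minimizer of $J_\infty$ over control laws with full model information) is $$u^{\mathrm{FMI}}(k)=-(I+B^\top P^{\mathrm{FMI}}B)^{-1}B^\top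 P^{\mathrm{FMI}}A(k)x(k),$$ where $P^{\mathrm{FMI}}$ is the unique positive-definite solution of $P=I+\mathbf{R}(\bar A,P,B,I)+\sum_{i=1}^N\mathbb{E}\{\mathbf{R}(\tilde A_i(k),P,B,I)\}$. In each cost the state $x(k)$ is the one generated by the corresponding controller from $x(0)=x_0$. A closed-loop system is mean square stable if $\lim_{k\to+\infty}\mathbb{E}\{x(k)^\top x(k)\}=0$ for every initial state $x_0$. The system is mean square stabilizable under limited model information if there exist (measurable) mappings $\Gamma_i:\mathbb{R}^{n_i\times n_1}\times\cdots\times\mathbb{R}^{n_i\times n_N}\to\mathbb{R}^{m_i\times n}$, $1\le i\le N$, such that the closed-loop system with $u_i(k)=\Gamma_i(A_{i1}(k),\dots,A_{iN}(k))x(k)$, $1\le i\le N$, is mean square stable. *)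

theory Defs
  imports "HOL-Probability.Probability"
begin

text \<open>
  The state space is \<open>real^'n\<close>, the input space \<open>real^'m\<close>, and the subsystems are the elements
  of the finite type \<open>'s\<close>. The partition into subsystems is given by \<open>blk :: 'n \<Rightarrow> 's\<close> and
  \<open>ublk :: 'm \<Rightarrow> 's\<close>: subsystem \<open>i\<close> owns the state coordinates \<open>a\<close> with \<open>blk a = i\<close> and the
  input coordinates \<open>b\<close> with \<open>ublk b = i\<close>. A block of a matrix is represented by the full-size
  matrix that agrees with it on the block and is zero elsewhere.
\<close>

definition pos_def :: "real^'n^'n \<Rightarrow> bool" where
  "pos_def P \<longleftrightarrow> transpose P = P \<and> (\<forall>x. x \<noteq> 0 \<longrightarrow> 0 < x \<bullet> (P *v x))"

definition kronecker :: "real^'b^'a \<Rightarrow> real^'d^'c \<Rightarrow> real^('b \<times> 'd)^('a \<times> 'c)" where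
  "kronecker X Y = (\<chi> p q. X $ fst p $ fst q * Y $ snd p $ snd q)"

definition riccati :: "real^'n^'n \<Rightarrow> real^'n^'n \<Rightarrow> real^'m^'n \<Rightarrow> real^'m^'m \<Rightarrow> real^'n^'n" where
  "riccati A P B R =
     transpose A **
       (P - P ** B ** matrix_inv (R + transpose B ** P ** B) ** transpose B ** P) ** A"

definition block_row :: "('n \<Rightarrow> 's) \<Rightarrow> 's \<Rightarrow> real^'c^'n \<Rightarrow> real^'c^'n" where
  "block_row blk i X = (\<chi> a c. if blk a = i then X $ a $ c else 0)"

text \<open>
  Zero padding of \<open>B\<^sub>i\<close> does not change \<open>B\<^sub>i (I + B\<^sub>i\<^sup>T P B\<^sub>i)\<^sup>-\<^sup>1 B\<^sub>i\<^sup>T\<close>: the padded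
  \<open>I + B\<^sub>i\<^sup>T P B\<^sub>i\<close> is block diagonal, with the identity outside the block \<open>i\<close>.
\<close>

definition block_col :: "('m \<Rightarrow> 's) \<Rightarrow> 's \<Rightarrow> real^'m^'n \<Rightarrow> real^'m^'n" where
  "block_col ublk i X = (\<chi> a b. if ublk b = i then X $ a $ b else 0)"

definition block_diagonal :: "('n \<Rightarrow> 's) \<Rightarrow> ('m \<Rightarrow> 's) \<Rightarrow> real^'m^'n \<Rightarrow> bool" where
  "block_diagonal blk ublk X \<longleftrightarrow> (\<forall>a b. blk a \<noteq> ublk b \<longrightarrow> X $ a $ b = 0)"

text \<open>
  The singular values of the \<open>(i,i)\<close> block are the square roots of the eigenvalues of
  \<open>X\<^sub>i\<^sub>i\<^sup>T X\<^sub>i\<^sub>i\<close>. The eigenvectors have to be supported on the block, since the padding would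
  otherwise contribute spurious zero singular values.
\<close>

definition block_singular_values ::
    "('n \<Rightarrow> 's) \<Rightarrow> ('m \<Rightarrow> 's) \<Rightarrow> 's \<Rightarrow> real^'m^'n \<Rightarrow> real set" where
  "block_singular_values blk ublk i X =
     (let Xii = block_row blk i (block_col ublk i X) in
      {s. 0 \<le> s \<and> (\<exists>v. v \<noteq> 0 \<and> (\<forall>b. ublk b \<noteq> i \<longrightarrow> v $ b = 0) \<and>
                    (transpose Xii ** Xii) *v v = s\<^sup>2 *\<^sub>R v)})"

definition min_block_singular_value ::
    "('n \<Rightarrow> 's) \<Rightarrow> ('m \<Rightarrow> 's) \<Rightarrow> 's \<Rightarrow> real^'m^'n \<Rightarrow> real" where
  "min_block_singular_value blk ublk i X = Min (block_singular_values blk ublk i X)"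

primrec state ::
    "(nat \<Rightarrow> 'w \<Rightarrow> real^'n^'n) \<Rightarrow> real^'m^'n \<Rightarrow> real^'n \<Rightarrow> (nat \<Rightarrow> 'w \<Rightarrow> real^'m) \<Rightarrow>
     nat \<Rightarrow> 'w \<Rightarrow> real^'n" where
  "state A B x0 u 0 \<omega> = x0"
| "state A B x0 u (Suc k) \<omega> = A k \<omega> *v state A B x0 u k \<omega> + B *v u k \<omega>"

text \<open>
  The partial costs are nondecreasing in \<open>T\<close>, so the limit exists in the extended nonnegative
  reals.
\<close>

definition cost ::
    "'w measure \<Rightarrow> (nat \<Rightarrow> 'w \<Rightarrow> real^'n^'n) \<Rightarrow> real^'m^'n \<Rightarrow> real^'n \<Rightarrow>
     (nat \<Rightarrow> 'w \<Rightarrow> real^'m) \<Rightarrow> ennreal" where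
  "cost M A B x0 u =
     lim (\<lambda>T. \<integral>\<^sup>+\<omega>. ennreal (\<Sum>k<T. state A B x0 u k \<omega> \<bullet> state A B x0 u k \<omega> + u k \<omega> \<bullet> u k \<omega>) \<partial>M)"

primrec feedback_state ::
    "(nat \<Rightarrow> 'w \<Rightarrow> real^'n^'n) \<Rightarrow> real^'m^'n \<Rightarrow> (nat \<Rightarrow> 'w \<Rightarrow> real^'n^'m) \<Rightarrow> real^'n \<Rightarrow>
     nat \<Rightarrow> 'w \<Rightarrow> real^'n" where
  "feedback_state A B G x0 0 \<omega> = x0"
| "feedback_state A B G x0 (Suc k) \<omega> =
     A k \<omega> *v feedback_state A B G x0 k \<omega> + B *v (G k \<omega> *v feedback_state A B G x0 k \<omega>)"

definition feedback_input ::
    "(nat \<Rightarrow> 'w \<Rightarrow> real^'n^'n) \<Rightarrow> real^'m^'n \<Rightarrow> (nat \<Rightarrow> 'w \<Rightarrow> real^'n^'m) \<Rightarrow> real^'n \<Rightarrow>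
     nat \<Rightarrow> 'w \<Rightarrow> real^'m" where
  "feedback_input A B G x0 k \<omega> = G k \<omega> *v feedback_state A B G x0 k \<omega>"

lemma state_feedback_input:
  "state A B x0 (feedback_input A B G x0) k \<omega> = feedback_state A B G x0 k \<omega>"
  by (induction k) (simp_all add: feedback_input_def)

definition mean_square_stable ::
    "'w measure \<Rightarrow> (nat \<Rightarrow> 'w \<Rightarrow> real^'n^'n) \<Rightarrow> real^'m^'n \<Rightarrow> (nat \<Rightarrow> 'w \<Rightarrow> real^'n^'m) \<Rightarrow> bool" where
  "mean_square_stable M A B G \<longleftrightarrow>
     (\<forall>x0. (\<lambda>k. \<integral>\<^sup>+\<omega>. ennreal (feedback_state A B G x0 k \<omega> \<bullet> feedback_state A B G x0 k \<omega>) \<partial>M)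
             \<longlonglongrightarrow> 0)"

text \<open>Only the rows of \<open>\<Gamma> i\<close> belonging to the inputs of subsystem \<open>i\<close> are used.\<close>

definition stabilizable_limited_info ::
    "'w measure \<Rightarrow> ('n \<Rightarrow> 's) \<Rightarrow> ('m \<Rightarrow> 's) \<Rightarrow> (nat \<Rightarrow> 'w \<Rightarrow> real^'n^'n) \<Rightarrow> real^'m^'n \<Rightarrow> bool" where
  "stabilizable_limited_info M blk ublk A B \<longleftrightarrow>
     (\<exists>\<Gamma> :: 's \<Rightarrow> real^'n^'n \<Rightarrow> real^'n^'m.
        (\<forall>i. \<Gamma> i \<in> borel \<rightarrow>\<^sub>M borel) \<and>
        mean_square_stable M A B
          (\<lambda>k \<omega>. \<chi> b. \<Gamma> (ublk b) (block_row blk (ublk b) (A k \<omega>)) $ b))"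

text \<open>
  The history \<open>x(0), \<dots>, x(k)\<close> is an element of the product space over the index set \<open>{..k}\<close>.
  Only the components of \<open>\<psi> i\<close> belonging to the inputs of subsystem \<open>i\<close> are used.
\<close>

definition limited_info ::
    "'w measure \<Rightarrow> ('n \<Rightarrow> 's) \<Rightarrow> ('m \<Rightarrow> 's) \<Rightarrow> (nat \<Rightarrow> 'w \<Rightarrow> real^'n^'n) \<Rightarrow> real^'m^'n \<Rightarrow> real^'n \<Rightarrow>
     (nat \<Rightarrow> 'w \<Rightarrow> real^'m) \<Rightarrow> bool" where
  "limited_info M blk ublk A B x0 u \<longleftrightarrow>
     (\<exists>\<psi> :: 's \<Rightarrow> nat \<Rightarrow> (real^'n^'n) \<times> (nat \<Rightarrow> real^'n) \<Rightarrow> real^'m.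
        (\<forall>i k. \<psi> i k \<in> borel \<Otimes>\<^sub>M (\<Pi>\<^sub>M j\<in>{..k}. borel) \<rightarrow>\<^sub>M borel) \<and>
        (\<forall>k. \<forall>\<omega>\<in>space M. \<forall>b.
           u k \<omega> $ b =
             \<psi> (ublk b) k (block_row blk (ublk b) (A k \<omega>), \<lambda>j\<in>{..k}. state A B x0 u j \<omega>) $ b))"

definition full_info ::
    "'w measure \<Rightarrow> (nat \<Rightarrow> 'w \<Rightarrow> real^'n^'n) \<Rightarrow> real^'m^'n \<Rightarrow> real^'n \<Rightarrow>
     (nat \<Rightarrow> 'w \<Rightarrow> real^'m) \<Rightarrow> bool" where
  "full_info M A B x0 u \<longleftrightarrow>
     (\<exists>\<psi> :: nat \<Rightarrow> (real^'n^'n) \<times> (nat \<Rightarrow> real^'n) \<Rightarrow> real^'m.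
        (\<forall>k. \<psi> k \<in> borel \<Otimes>\<^sub>M (\<Pi>\<^sub>M j\<in>{..k}. borel) \<rightarrow>\<^sub>M borel) \<and>
        (\<forall>k. \<forall>\<omega>\<in>space M. u k \<omega> = \<psi> k (A k \<omega>, \<lambda>j\<in>{..k}. state A B x0 u j \<omega>)))"

definition optimal_limited_info ::
    "'w measure \<Rightarrow> ('n \<Rightarrow> 's) \<Rightarrow> ('m \<Rightarrow> 's) \<Rightarrow> (nat \<Rightarrow> 'w \<Rightarrow> real^'n^'n) \<Rightarrow> real^'m^'n \<Rightarrow> real^'n \<Rightarrow>
     (nat \<Rightarrow> 'w \<Rightarrow> real^'m) \<Rightarrow> bool" where
  "optimal_limited_info M blk ublk A B x0 u \<longleftrightarrow>
     limited_info M blk ublk A B x0 u \<and>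
     (\<forall>v. limited_info M blk ublk A B x0 v \<longrightarrow> cost M A B x0 u \<le> cost M A B x0 v)"

definition optimal_full_info ::
    "'w measure \<Rightarrow> (nat \<Rightarrow> 'w \<Rightarrow> real^'n^'n) \<Rightarrow> real^'m^'n \<Rightarrow> real^'n \<Rightarrow>
     (nat \<Rightarrow> 'w \<Rightarrow> real^'m) \<Rightarrow> bool" where
  "optimal_full_info M A B x0 u \<longleftrightarrow>
     full_info M A B x0 u \<and>
     (\<forall>v. full_info M A B x0 v \<longrightarrow> cost M A B x0 u \<le> cost M A B x0 v)"

definition Atilde ::
    "'w measure \<Rightarrow> ('n \<Rightarrow> 's) \<Rightarrow> (nat \<Rightarrow> 'w \<Rightarrow> real^'n^'n) \<Rightarrow> 's \<Rightarrow> nat \<Rightarrow> 'w \<Rightarrow> real^'n^'n" where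
  "Atilde M blk A i k \<omega> = block_row blk i (A k \<omega> - integral\<^sup>L M (A k))"

definition P_LMI ::
    "'w measure \<Rightarrow> ('n \<Rightarrow> 's::finite) \<Rightarrow> ('m \<Rightarrow> 's) \<Rightarrow> (nat \<Rightarrow> 'w \<Rightarrow> real^'n^'n) \<Rightarrow> real^'n^'n \<Rightarrow>
     real^'m^'n \<Rightarrow> real^'n^'n" where
  "P_LMI M blk ublk A Abar B =
     (THE P. pos_def P \<and>
        (\<forall>k. P = mat 1 + riccati Abar P B (mat 1) +
               (\<Sum>i\<in>UNIV. \<integral>\<omega>. riccati (Atilde M blk A i k \<omega>) P (block_col ublk i B) (mat 1) \<partial>M)))"

definition P_FMI ::
    "'w measure \<Rightarrow> ('n \<Rightarrow> 's::finite) \<Rightarrow> (nat \<Rightarrow> 'w \<Rightarrow> real^'n^'n) \<Rightarrow> real^'n^'n \<Rightarrow>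
     real^'m^'n \<Rightarrow> real^'n^'n" where
  "P_FMI M blk A Abar B =
     (THE P. pos_def P \<and>
        (\<forall>k. P = mat 1 + riccati Abar P B (mat 1) +
               (\<Sum>i\<in>UNIV. \<integral>\<omega>. riccati (Atilde M blk A i k \<omega>) P B (mat 1) \<partial>M)))"

definition gain_LMI ::
    "'w measure \<Rightarrow> ('n \<Rightarrow> 's::finite) \<Rightarrow> ('m \<Rightarrow> 's) \<Rightarrow> (nat \<Rightarrow> 'w \<Rightarrow> real^'n^'n) \<Rightarrow> real^'n^'n \<Rightarrow>
     real^'m^'n \<Rightarrow> nat \<Rightarrow> 'w \<Rightarrow> real^'n^'m" where
  "gain_LMI M blk ublk A Abar B k \<omega> =
     (let P = P_LMI M blk ublk A Abar B in
      - (matrix_inv (mat 1 + transpose B ** P ** B) ** transpose B ** P ** Abar)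
      - (\<chi> b. let i = ublk b; Bi = block_col ublk i B in
               (matrix_inv (mat 1 + transpose Bi ** P ** Bi) ** transpose Bi ** P
                  ** Atilde M blk A i k \<omega>) $ b))"

definition gain_FMI ::
    "'w measure \<Rightarrow> ('n \<Rightarrow> 's::finite) \<Rightarrow> (nat \<Rightarrow> 'w \<Rightarrow> real^'n^'n) \<Rightarrow> real^'n^'n \<Rightarrow>
     real^'m^'n \<Rightarrow> nat \<Rightarrow> 'w \<Rightarrow> real^'n^'m" where
  "gain_FMI M blk A Abar B k \<omega> =
     (let P = P_FMI M blk A Abar B in
      - (matrix_inv (mat 1 + transpose B ** P ** B) ** transpose B ** P ** A k \<omega>))"

definition u_LMI ::
    "'w measure \<Rightarrow> ('n \<Rightarrow> 's::finite) \<Rightarrow> ('m \<Rightarrow> 's) \<Rightarrow> (nat \<Rightarrow> 'w \<Rightarrow> real^'n^'n) \<Rightarrow> real^'n^'n \<Rightarrow>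
     real^'m^'n \<Rightarrow> real^'n \<Rightarrow> nat \<Rightarrow> 'w \<Rightarrow> real^'m" where
  "u_LMI M blk ublk A Abar B = feedback_input A B (gain_LMI M blk ublk A Abar B)"

definition u_FMI ::
    "'w measure \<Rightarrow> ('n \<Rightarrow> 's::finite) \<Rightarrow> (nat \<Rightarrow> 'w \<Rightarrow> real^'n^'n) \<Rightarrow> real^'n^'n \<Rightarrow>
     real^'m^'n \<Rightarrow> real^'n \<Rightarrow> nat \<Rightarrow> 'w \<Rightarrow> real^'m" where
  "u_FMI M blk A Abar B = feedback_input A B (gain_FMI M blk A Abar B)"

text \<open>
  In the extended nonnegative reals \<open>\<infinity> / \<infinity> = 0\<close>; the case distinction keeps an infinite
  denominator from making the ratio small.
\<close>

definition performance_ratio ::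
    "'w measure \<Rightarrow> (nat \<Rightarrow> 'w \<Rightarrow> real^'n^'n) \<Rightarrow> real^'m^'n \<Rightarrow>
     (real^'n \<Rightarrow> nat \<Rightarrow> 'w \<Rightarrow> real^'m) \<Rightarrow> (real^'n \<Rightarrow> nat \<Rightarrow> 'w \<Rightarrow> real^'m) \<Rightarrow> ennreal" where
  "performance_ratio M A B u v =
     (SUP x0\<in>{x0. x0 \<noteq> 0}.
        if cost M A B x0 (v x0) = \<infinity> then \<infinity> else cost M A B x0 (u x0) / cost M A B x0 (v x0))"

end

theory Submission
  imports Defs
begin

text \<open>
  The bound comes from comparing both optimal controllers with the deadbeat controller
  \<open>u(k) = - B\<^sup>-\<^sup>1 A(k) x(k)\<close>. Since \<open>B\<close> is block diagonal and square on each block, it has a block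
  diagonal inverse \<open>D\<close>, so the deadbeat controller uses limited model information only. It brings
  the state to zero in one step and costs
  \<open>J\<^sub>D(x\<^sub>0) = |x\<^sub>0|\<^sup>2 + E |D A(0) x\<^sub>0|\<^sup>2\<close>. On the other hand, whatever the control law is,
  its cost is at least \<open>E (|x\<^sub>0|\<^sup>2 + |u(0)|\<^sup>2 + |x(1)|\<^sup>2)\<close>, where \<open>x(1) = A(0) x\<^sub>0 + B u(0)\<close>; from
  \<open>D A(0) x\<^sub>0 = D x(1) - u(0)\<close>, \<open>|D z| \<le> |z| / \<epsilon>\<close> and the Cauchy-Schwarz inequality,
  \<open>|D A(0) x\<^sub>0|\<^sup>2 \<le> (1 + 1/\<epsilon>\<^sup>2) (|u(0)|\<^sup>2 + |x(1)|\<^sup>2)\<close> holds pointwise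
  (\<open>inverse_input_bound\<close>, \<open>deadbeat_cost_le_cost\<close>). Hence every controller that costs at most
  \<open>J\<^sub>D\<close> is within the factor \<open>1 + 1/\<epsilon>\<^sup>2\<close> of every other controller of finite cost
  (\<open>performance_ratio_le\<close>). Minimizers over limited model information cost at most \<open>J\<^sub>D\<close>, which
  settles the ratio of any two optimal controllers.

  For the explicit controllers it remains to analyse the Riccati equations, which are treated
  together by letting a family \<open>Bf i\<close> of input matrices be either the block columns of \<open>B\<close> or
  \<open>B\<close> itself. The right-hand side \<open>F\<close> is monotone, satisfies
  \<open>F(tP) \<ge> t F(P) + (1 - t) I\<close> for \<open>0 \<le> t \<le> 1\<close>, and is bounded by the quadratic form \<open>J\<^sub>D\<close>, because
  \<open>u = - D y\<close> is admissible in the minimization that defines the Riccati operator. Such a map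
  has exactly one positive definite fixed point (\<open>ex1_pos_def_fixed_point\<close>), and this fixed
  point \<open>P\<close> satisfies \<open>x\<^sup>T P x \<le> J\<^sub>D(x)\<close>. Since the block rows are uncorrelated, the form of \<open>P\<close> is the
  exact cost-to-go for one step of the feedback given by \<open>P\<close>, and the costs telescope
  (\<open>feedback_gain_stage_cost\<close>, \<open>feedback_cost_le\<close>), so its cost is at most \<open>x\<^sub>0\<^sup>T P x\<^sub>0\<close>.
\<close>

section \<open>Quadratic forms and completing the square\<close>

lemma inner_matrix_vector:
  fixes A :: "real^'a^'b"
  shows "x \<bullet> (A *v y) = (transpose A *v x) \<bullet> y"
  by (simp add: dot_lmul_matrix[symmetric])

lemma inner_matrix_vector_sum:
  fixes N :: "real^'a^'b"
  shows "x \<bullet> (N *v y) = (\<Sum>a\<in>UNIV. \<Sum>b\<in>UNIV. N $ a $ b * (x $ a * y $ b))"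
  by (simp add: inner_vec_def matrix_vector_mult_def sum_distrib_left ac_simps)

lemma inner_symmetric_matrix:
  fixes P :: "real^'n^'n"
  assumes "transpose P = P"
  shows "x \<bullet> (P *v y) = y \<bullet> (P *v x)"
  using inner_matrix_vector[of x P y] assms by (simp add: inner_commute)

lemma transpose_add: "transpose (X + Y) = transpose X + transpose (Y :: real^'a^'b)"
  by (vector transpose_def)

lemma transpose_diff: "transpose (X - Y) = transpose X - transpose (Y :: real^'a^'b)"
  by (vector transpose_def)

lemma matrix_vector_mult_minus: "A *v (- x) = - (A *v x)" for A :: "real^'a^'b"
  using matrix_vector_mult_diff_distrib[of A 0 x] by simp

lemma symmetric_matrix_eqI:
  fixes P Q :: "real^'n^'n"
  assumes P: "transpose P = P" and Q: "transpose Q = Q"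
    and eq: "\<And>x. x \<bullet> (P *v x) = x \<bullet> (Q *v x)"
  shows "P = Q"
proof -
  have "x \<bullet> (P *v y) = x \<bullet> (Q *v y)" for x y
    using eq[of "x + y"] eq[of x] eq[of y]
      inner_symmetric_matrix[OF P, of x y] inner_symmetric_matrix[OF Q, of x y]
    by (simp add: matrix_vector_right_distrib inner_add_left inner_add_right)
  then show ?thesis
    by (metis matrix_eq vector_eq_ldot)
qed

text \<open>Symmetric positive semidefinite matrices, in the same form as \<open>pos_def\<close>.\<close>

definition pos_semidef :: "real^'n^'n \<Rightarrow> bool" where
  "pos_semidef P \<longleftrightarrow> transpose P = P \<and> (\<forall>x. 0 \<le> x \<bullet> (P *v x))"

lemma pos_def_imp_pos_semidef: "pos_def P \<Longrightarrow> pos_semidef P"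
  unfolding pos_def_def pos_semidef_def by (metis inner_zero_left less_eq_real_def)

text \<open>The gain of the optimal one-step feedback: for positive semidefinite \<open>P\<close>, \<open>u = - gain P B *v y\<close> minimizes
  \<open>|u|\<^sup>2 + (y + B u)\<^sup>T P (y + B u)\<close> over \<open>u\<close>.\<close>

definition gain :: "real^'n^'n \<Rightarrow> real^'m^'n \<Rightarrow> real^'n^'m" where
  "gain P B = matrix_inv (mat 1 + transpose B ** P ** B) ** transpose B ** P"

text \<open>The matrix of the minimal value of that problem as a quadratic form in \<open>y\<close>. The Riccati
  operator with \<open>R = I\<close> is the congruence of this matrix by \<open>A\<close>.\<close>

definition riccati_form :: "real^'n^'n \<Rightarrow> real^'m^'n \<Rightarrow> real^'n^'n" where
  "riccati_form P B =
     P - P ** B ** matrix_inv (mat 1 + transpose B ** P ** B) ** transpose B ** P"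

text \<open>The cost of input \<open>u\<close> when the uncontrolled successor state is \<open>y\<close> and the cost-to-go is the
  quadratic form of \<open>P\<close>.\<close>

definition stage_cost :: "real^'n^'n \<Rightarrow> real^'m^'n \<Rightarrow> real^'n \<Rightarrow> real^'m \<Rightarrow> real" where
  "stage_cost P B y u = u \<bullet> u + (y + B *v u) \<bullet> (P *v (y + B *v u))"

lemma matrix_inv_right:
  fixes W :: "real^'n^'n"
  assumes "invertible W"
  shows "W ** matrix_inv W = mat 1"
  using someI_ex[OF assms[unfolded invertible_def]] by (simp add: matrix_inv_def)

lemma riccati_eq: "riccati A P B (mat 1) = transpose A ** riccati_form P B ** A"
  by (simp add: riccati_def riccati_form_def)

lemma invertible_one_plus:
  fixes B :: "real^'m^'n"
  assumes "pos_semidef P"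
  shows "invertible (mat 1 + transpose B ** P ** B)"
proof -
  let ?W = "mat 1 + transpose B ** P ** B"
  have "u = 0" if "?W *v u = 0" for u
  proof -
    have "0 = u \<bullet> (?W *v u)" using that by simp
    also have "\<dots> = u \<bullet> u + (B *v u) \<bullet> (P *v (B *v u))"
      by (simp add: matrix_vector_mult_add_rdistrib inner_add_right inner_matrix_vector
          matrix_vector_mul_assoc[symmetric] matrix_transpose_mul del: transpose_matrix_vector vector_transpose_matrix)
    finally have "u \<bullet> u \<le> 0"
      using assms unfolding pos_semidef_def by (metis add_increasing2 nle_le order_refl)
    then show ?thesis by (metis inner_gt_zero_iff not_less)
  qed
  then show ?thesis
    by (meson invertible_left_inverse matrix_left_invertible_ker)
qed

text \<open>The first-order condition for \<open>w = - gain P B *v y\<close>, namely \<open>w + B\<^sup>T P (y + B w) = 0\<close>.\<close>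

lemma gain_stationary:
  fixes B :: "real^'m^'n"
  assumes "pos_semidef P"
  shows "- (gain P B *v y) + transpose B *v (P *v (y + B *v (- (gain P B *v y)))) = 0"
proof -
  let ?W = "mat 1 + transpose B ** P ** B"
  have "?W ** matrix_inv ?W = mat 1"
    by (rule matrix_inv_right[OF invertible_one_plus[OF assms]])
  then have "?W *v (gain P B *v y) = transpose B *v (P *v y)"
    by (simp add: gain_def matrix_vector_mul_assoc matrix_mul_assoc
        del: transpose_matrix_vector vector_transpose_matrix)
  then have "gain P B *v y + transpose B *v (P *v (B *v (gain P B *v y))) = transpose B *v (P *v y)"
    by (simp add: matrix_vector_mult_add_rdistrib matrix_vector_mul_assoc[symmetric]
        del: transpose_matrix_vector vector_transpose_matrix)
  then show ?thesis
    by (simp add: matrix_vector_right_distrib matrix_vector_mult_minus algebra_simps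
        del: transpose_matrix_vector vector_transpose_matrix)
qed

lemma riccati_form_eq:
  fixes B :: "real^'m^'n"
  shows "riccati_form P B *v y = P *v (y + B *v (- (gain P B *v y)))"
  by (simp add: riccati_form_def gain_def matrix_vector_mult_diff_rdistrib matrix_vector_right_distrib
      matrix_vector_mult_minus matrix_vector_mult_diff_distrib matrix_vector_mul_assoc matrix_mul_assoc)

lemma stage_cost_shift:
  fixes B :: "real^'m^'n"
  assumes P: "pos_semidef P"
  shows "stage_cost P B y (- (gain P B *v y) + d) =
    y \<bullet> (riccati_form P B *v y) + d \<bullet> d + (B *v d) \<bullet> (P *v (B *v d))"
proof -
  define w where "w = - (gain P B *v y)"
  define p where "p = P *v (y + B *v w)"
  have sym: "transpose P = P" using P by (simp add: pos_semidef_def)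
  have st: "w + transpose B *v p = 0"
    using gain_stationary[OF P, of B y] unfolding w_def p_def .
  have Bp: "(B *v e) \<bullet> p = - (e \<bullet> w)" for e
  proof -
    have "(B *v e) \<bullet> p = e \<bullet> (transpose B *v p)"
      by (metis inner_matrix_vector inner_commute)
    also have "transpose B *v p = - w" using st by (simp add: eq_neg_iff_add_eq_0 add.commute)
    finally show ?thesis by simp
  qed
  have rf: "riccati_form P B *v y = p"
    unfolding p_def w_def by (rule riccati_form_eq)
  have "(y + B *v (w + d)) \<bullet> (P *v (y + B *v (w + d))) =
      (y + B *v w) \<bullet> p + 2 * ((B *v d) \<bullet> p) + (B *v d) \<bullet> (P *v (B *v d))"
    using inner_symmetric_matrix[OF sym, of "B *v d" "y + B *v w"]
    unfolding p_def
    by (simp add: matrix_vector_right_distrib inner_add_left inner_add_right)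
  also have "(y + B *v w) \<bullet> p = y \<bullet> p - w \<bullet> w"
    using Bp[of w] by (simp add: inner_add_left)
  finally show ?thesis
    unfolding stage_cost_def w_def[symmetric] rf using Bp[of d]
    by (simp add: inner_add_left inner_add_right inner_commute)
qed

lemma stage_cost_gain:
  fixes B :: "real^'m^'n"
  assumes "pos_semidef P"
  shows "stage_cost P B y (- (gain P B *v y)) = y \<bullet> (riccati_form P B *v y)"
  using stage_cost_shift[OF assms, of B y 0] by simp

lemma riccati_form_le_stage_cost:
  fixes B :: "real^'m^'n"
  assumes "pos_semidef P"
  shows "y \<bullet> (riccati_form P B *v y) \<le> stage_cost P B y u"
proof -
  have "stage_cost P B y u = y \<bullet> (riccati_form P B *v y) + (u + gain P B *v y) \<bullet> (u + gain P B *v y)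
      + (B *v (u + gain P B *v y)) \<bullet> (P *v (B *v (u + gain P B *v y)))"
    using stage_cost_shift[OF assms, of B y "u + gain P B *v y"] by simp
  moreover have "0 \<le> (B *v (u + gain P B *v y)) \<bullet> (P *v (B *v (u + gain P B *v y)))"
    using assms by (simp add: pos_semidef_def)
  ultimately show ?thesis using inner_ge_zero[of "u + gain P B *v y"] by linarith
qed

lemma riccati_form_nonneg:
  fixes B :: "real^'m^'n"
  assumes "pos_semidef P"
  shows "0 \<le> y \<bullet> (riccati_form P B *v y)"
  using assms unfolding stage_cost_gain[OF assms, symmetric] stage_cost_def pos_semidef_def
  by simp

text \<open>Monotonicity and subhomogeneity at once. For a fixed input \<open>u\<close>, scaling the stage cost of \<open>P\<close>
  by \<open>t \<le> 1\<close> leaves it below the stage cost of \<open>Q\<close>; the optimal input for \<open>Q\<close> is then used for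
  both. For negative \<open>t\<close> the two sides have opposite signs.\<close>

lemma riccati_form_mono:
  fixes B :: "real^'m^'n"
  assumes P: "pos_semidef P" and Q: "pos_semidef Q"
    and le: "\<And>x. t * (x \<bullet> (P *v x)) \<le> x \<bullet> (Q *v x)" and t: "t \<le> 1"
  shows "t * (y \<bullet> (riccati_form P B *v y)) \<le> y \<bullet> (riccati_form Q B *v y)"
proof (cases "0 \<le> t")
  case True
  define u where "u = - (gain Q B *v y)"
  have "t * (y \<bullet> (riccati_form P B *v y)) \<le> t * stage_cost P B y u"
    by (rule mult_left_mono[OF riccati_form_le_stage_cost[OF P] True])
  also have "\<dots> = t * (u \<bullet> u) + t * ((y + B *v u) \<bullet> (P *v (y + B *v u)))"
    by (simp add: stage_cost_def distrib_left)
  also have "\<dots> \<le> stage_cost Q B y u"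
    using mult_right_mono[OF t inner_ge_zero[of u]] le[of "y + B *v u"] by (simp add: stage_cost_def)
  also have "\<dots> = y \<bullet> (riccati_form Q B *v y)"
    unfolding u_def by (rule stage_cost_gain[OF Q])
  finally show ?thesis .
next
  case False
  then show ?thesis
    using riccati_form_nonneg[OF P, of y B] riccati_form_nonneg[OF Q, of y B]
    by (meson mult_nonpos_nonneg nle_le order_trans)
qed

lemma riccati_form_symmetric:
  fixes B :: "real^'m^'n"
  assumes P: "pos_semidef P"
  shows "transpose (riccati_form P B) = riccati_form P B"
proof -
  let ?W = "mat 1 + transpose B ** P ** B"
  have sym: "transpose P = P" using P by (simp add: pos_semidef_def)
  have inv: "invertible ?W" by (rule invertible_one_plus[OF P])
  have W: "transpose ?W = ?W"
    by (simp add: transpose_add matrix_transpose_mul sym matrix_mul_assoc)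
  have "transpose (matrix_inv ?W) ** ?W = mat 1"
    using arg_cong[OF matrix_inv_right[OF inv], of transpose]
    by (simp only: matrix_transpose_mul W transpose_mat)
  then have "transpose (matrix_inv ?W) = matrix_inv ?W"
    by (metis inv matrix_inv_right matrix_mul_assoc matrix_mul_lid matrix_mul_rid)
  then show ?thesis
    by (simp add: riccati_form_def transpose_diff matrix_transpose_mul sym matrix_mul_assoc)
qed

section \<open>Fixed points of subhomogeneous monotone matrix maps\<close>

text \<open>Taking \<open>t = 0\<close> and \<open>t = 1\<close>, the hypothesis \<open>sub\<close> says that \<open>F P \<ge> I\<close> and that \<open>F\<close> is
  monotone in the Loewner order. As \<open>F\<close> is bounded by \<open>c I\<close>, the term \<open>(1 - t) I\<close> dominates
  \<open>(1 - t) F(P) / c\<close>. Hence an inequality \<open>t P \<le> Q\<close> improves to \<open>t' F(P) \<le> F(Q)\<close> with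
  \<open>1 - t' = (1 - 1/c) (1 - t)\<close>. Iterating from the trivial case \<open>t = 0\<close> makes \<open>t\<close> tend to 1.
  Applied to two fixed points, this gives uniqueness. Applied to the increasing
  iterates of \<open>F\<close> from \<open>0\<close>, it shows that their limit is a fixed point, with no appeal to the
  continuity of \<open>F\<close>.\<close>

lemma ex1_pos_def_fixed_point:
  fixes F :: "real^'n^'n \<Rightarrow> real^'n^'n"
  assumes sym: "\<And>P. pos_semidef P \<Longrightarrow> transpose (F P) = F P"
    and sub: "\<And>P Q t x. pos_semidef P \<Longrightarrow> pos_semidef Q \<Longrightarrow> t \<le> 1 \<Longrightarrow>
        (\<And>x. t * (x \<bullet> (P *v x)) \<le> x \<bullet> (Q *v x)) \<Longrightarrow>
        t * (x \<bullet> (F P *v x)) + (1 - t) * (x \<bullet> x) \<le> x \<bullet> (F Q *v x)"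
    and bd: "\<And>P x. pos_semidef P \<Longrightarrow> x \<bullet> (F P *v x) \<le> c * (x \<bullet> x)" and c: "1 \<le> c"
  shows "\<exists>!P. pos_def P \<and> P = F P"
proof -
  define t where "t k = 1 - (1 - 1/c) ^ k" for k
  have t1: "t k \<le> 1" for k using c by (simp add: t_def)
  have tS: "t (Suc k) = 1 - (1 - 1/c) * (1 - t k)" for k by (simp add: t_def)
  have tlim: "t \<longlonglongrightarrow> 1"
  proof -
    have "(\<lambda>k. (1 - 1/c) ^ k) \<longlonglongrightarrow> 0"
    proof (rule LIMSEQ_power_zero)
      have "0 < 1/c" "1/c \<le> 1" using c by auto
      then show "norm (1 - 1/c) < 1" by simp
    qed
    then have "(\<lambda>k. 1 - (1 - 1/c) ^ k) \<longlonglongrightarrow> 1 - 0" by (intro tendsto_diff tendsto_const)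
    then show ?thesis by (simp add: t_def[abs_def])
  qed
  have step: "(1 - (1 - 1/c) * (1 - s)) * (x \<bullet> (F P *v x)) \<le> x \<bullet> (F Q *v x)"
    if P: "pos_semidef P" and Q: "pos_semidef Q" and s: "s \<le> 1"
      and le: "\<And>x. s * (x \<bullet> (P *v x)) \<le> x \<bullet> (Q *v x)" for P Q s x
  proof -
    have "x \<bullet> (F P *v x) / c \<le> x \<bullet> x"
      using bd[OF P, of x] c by (simp add: divide_simps mult.commute)
    then have "(1 - s) * (x \<bullet> (F P *v x) / c) \<le> (1 - s) * (x \<bullet> x)"
      using s by (intro mult_left_mono) auto
    moreover have "(1 - (1 - 1/c) * (1 - s)) * (x \<bullet> (F P *v x)) =
        s * (x \<bullet> (F P *v x)) + (1 - s) * (x \<bullet> (F P *v x) / c)"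
      using c by (simp add: field_simps)
    ultimately show ?thesis using sub[OF P Q s le, of x] by linarith
  qed
  have F_ge: "x \<bullet> x \<le> x \<bullet> (F P *v x)" if "pos_semidef P" for P x
    using sub[OF that that, of 0 x] that by (simp add: pos_semidef_def)
  have F_pd: "pos_def (F P)" if "pos_semidef P" for P
    unfolding pos_def_def using sym[OF that] F_ge[OF that]
    by (metis inner_gt_zero_iff less_le_trans)
  have F_psd: "pos_semidef (F P)" if "pos_semidef P" for P
    by (rule pos_def_imp_pos_semidef[OF F_pd[OF that]])
  have mono: "x \<bullet> (F P *v x) \<le> x \<bullet> (F Q *v x)"
    if "pos_semidef P" "pos_semidef Q" "\<And>x. x \<bullet> (P *v x) \<le> x \<bullet> (Q *v x)" for P Q x
    using sub[OF that(1,2), of 1 x] that(3) by simp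
  have le: "x \<bullet> (P *v x) \<le> x \<bullet> (Q *v x)"
    if P: "pos_def P" "P = F P" and Q: "pos_def Q" "Q = F Q" for P Q x
  proof -
    have psd: "pos_semidef P" "pos_semidef Q" using P Q by (auto intro: pos_def_imp_pos_semidef)
    have "t k * (x \<bullet> (P *v x)) \<le> x \<bullet> (Q *v x)" for k x
    proof (induction k arbitrary: x)
      case 0
      then show ?case using psd by (simp add: t_def pos_semidef_def)
    next
      case (Suc k)
      show ?case
        using step[OF psd t1 Suc, of x] unfolding tS P(2)[symmetric] Q(2)[symmetric] .
    qed
    moreover have "(\<lambda>k. t k * (x \<bullet> (P *v x))) \<longlonglongrightarrow> 1 * (x \<bullet> (P *v x))"
      by (intro tendsto_intros tlim)
    ultimately show ?thesis
      using LIMSEQ_le_const2[of "\<lambda>k. t k * (x \<bullet> (P *v x))"] by (metis mult_1)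
  qed
  define S where "S k = (F ^^ k) 0" for k
  have S0: "S 0 = 0" and SS: "S (Suc k) = F (S k)" for k by (simp_all add: S_def)
  have S_psd: "pos_semidef (S k)" for k
  proof (induction k)
    case 0
    then show ?case by (simp add: S0 pos_semidef_def transpose_def vec_eq_iff)
  next
    case (Suc k)
    then show ?case by (simp add: SS F_psd)
  qed
  have S_step: "x \<bullet> (S k *v x) \<le> x \<bullet> (S (Suc k) *v x)" for k x
  proof (induction k arbitrary: x)
    case 0
    then show ?case using S_psd[of 1] by (simp add: S0 pos_semidef_def)
  next
    case (Suc k)
    then show ?case using mono[OF S_psd S_psd Suc] by (simp add: SS)
  qed
  have S_bd: "x \<bullet> (S k *v x) \<le> c * (x \<bullet> x)" for k x
    by (cases k) (use bd[OF S_psd] c in \<open>simp_all add: S0 SS\<close>)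
  have S_cmp: "t k * (x \<bullet> (S m *v x)) \<le> x \<bullet> (S k *v x)" for k m x
  proof (induction k arbitrary: m x)
    case 0
    then show ?case by (simp add: S0 t_def)
  next
    case (Suc k)
    show ?case
    proof (cases m)
      case 0
      then show ?thesis using S_psd[of "Suc k"] by (simp add: S0 pos_semidef_def)
    next
      case (Suc m')
      show ?thesis using step[OF S_psd S_psd t1 Suc.IH] by (simp add: Suc SS tS)
    qed
  qed
  have form_conv: "convergent (\<lambda>k. x \<bullet> (S k *v x))" for x
  proof -
    have "incseq (\<lambda>k. x \<bullet> (S k *v x))" by (rule incseq_SucI) (rule S_step)
    then obtain L where "(\<lambda>k. x \<bullet> (S k *v x)) \<longlonglongrightarrow> L"
      by (rule incseq_convergent[where B = "c * (x \<bullet> x)"]) (use S_bd in auto)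
    then show ?thesis by (rule convergentI)
  qed
  \<comment> \<open>Entries of a symmetric matrix are recovered from its quadratic form by polarization.\<close>
  have entry_conv: "convergent (\<lambda>k. S k $ i $ j)" for i j
  proof -
    have e: "S k $ i $ j = (1/2) * ((axis i 1 + axis j 1) \<bullet> (S k *v (axis i 1 + axis j 1)) -
        axis i 1 \<bullet> (S k *v axis i 1) - axis j 1 \<bullet> (S k *v axis j 1))" for k
      using inner_symmetric_matrix[of "S k" "axis i 1" "axis j 1"] S_psd[of k]
      by (simp add: pos_semidef_def matrix_vector_right_distrib inner_add_left inner_add_right
          inner_axis inner_axis' matrix_vector_mult_basis column_def)
    show ?thesis unfolding e
      by (intro convergent_mult convergent_const convergent_diff form_conv)
  qed
  define P where "P = (\<chi> i j. lim (\<lambda>k. S k $ i $ j))"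
  have P_lim: "(\<lambda>k. S k $ i $ j) \<longlonglongrightarrow> P $ i $ j" for i j
    using entry_conv[of i j] by (simp add: P_def convergent_LIMSEQ_iff)
  have form_lim: "(\<lambda>k. x \<bullet> (S k *v x)) \<longlonglongrightarrow> x \<bullet> (P *v x)" for x
    unfolding inner_matrix_vector_sum by (intro tendsto_intros P_lim)
  have S_sym: "S k $ i $ j = S k $ j $ i" for k i j
  proof -
    have "transpose (S k) = S k" using S_psd[of k] unfolding pos_semidef_def by blast
    then have "transpose (S k) $ j $ i = S k $ j $ i" by (rule ssubst) (rule refl)
    then show ?thesis unfolding transpose_def vec_lambda_beta .
  qed
  have P_psd: "pos_semidef P"
    unfolding pos_semidef_def
  proof
    show "transpose P = P" by (simp add: P_def transpose_def vec_eq_iff S_sym)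
    show "\<forall>x. 0 \<le> x \<bullet> (P *v x)"
      using LIMSEQ_le_const[OF form_lim] S_psd by (metis pos_semidef_def)
  qed
  have S_le: "x \<bullet> (S k *v x) \<le> x \<bullet> (P *v x)" for k x
    by (rule incseq_le[OF incseq_SucI form_lim]) (rule S_step)
  have S_ge: "t k * (x \<bullet> (P *v x)) \<le> x \<bullet> (S k *v x)" for k x
    by (rule LIMSEQ_le_const2[OF tendsto_mult_left[OF form_lim]]) (use S_cmp in auto)
  have "P = F P"
  proof (rule symmetric_matrix_eqI)
    show "transpose P = P" using P_psd by (simp add: pos_semidef_def)
    show "transpose (F P) = F P" by (rule sym[OF P_psd])
    show "x \<bullet> (P *v x) = x \<bullet> (F P *v x)" for x
    proof (rule antisym)
      have "x \<bullet> (S (Suc k) *v x) \<le> x \<bullet> (F P *v x)" for k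
        unfolding SS by (rule mono[OF S_psd P_psd S_le])
      moreover have "(\<lambda>k. x \<bullet> (S (Suc k) *v x)) \<longlonglongrightarrow> x \<bullet> (P *v x)"
        using form_lim by (rule LIMSEQ_Suc)
      ultimately show "x \<bullet> (P *v x) \<le> x \<bullet> (F P *v x)"
        by (meson LIMSEQ_le_const2)
      have "t (Suc k) * (x \<bullet> (F P *v x)) \<le> x \<bullet> (P *v x)" for k
        using step[OF P_psd S_psd t1 S_ge, of k x] S_le[of x "Suc k"] by (simp add: SS tS)
      moreover have "(\<lambda>k. t (Suc k) * (x \<bullet> (F P *v x))) \<longlonglongrightarrow> 1 * (x \<bullet> (F P *v x))"
        by (intro tendsto_intros LIMSEQ_Suc tlim)
      ultimately show "x \<bullet> (F P *v x) \<le> x \<bullet> (P *v x)"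
        using LIMSEQ_le_const2[of "\<lambda>k. t (Suc k) * (x \<bullet> (F P *v x))"] by (metis mult_1)
    qed
  qed
  moreover from this have "pos_def P" using F_pd[OF P_psd] by metis
  moreover have "Q = P" if Q: "pos_def Q" "Q = F Q" for Q
  proof (rule symmetric_matrix_eqI)
    show "transpose Q = Q" "transpose P = P"
      using Q(1) \<open>pos_def P\<close> by (simp_all add: pos_def_def)
    show "x \<bullet> (Q *v x) = x \<bullet> (P *v x)" for x
      using le[OF Q \<open>pos_def P\<close> \<open>P = F P\<close>, of x] le[OF \<open>pos_def P\<close> \<open>P = F P\<close> Q, of x]
      by (rule antisym)
  qed
  ultimately show ?thesis by blast
qed

section \<open>Singular values and the inverse of a block diagonal matrix\<close>

text \<open>The part of a vector that belongs to subsystem \<open>i\<close>, padded with zeros.\<close>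

definition block_vec :: "('n \<Rightarrow> 's) \<Rightarrow> 's \<Rightarrow> real^'n \<Rightarrow> real^'n" where
  "block_vec blk i v = (\<chi> a. if blk a = i then v $ a else 0)"

lemma block_vec_nth [simp]: "block_vec blk i v $ a = (if blk a = i then v $ a else 0)"
  by (simp add: block_vec_def)

lemma block_row_mult_vec: "block_row blk i Z *v x = block_vec blk i (Z *v x)"
  by (simp add: vec_eq_iff block_row_def matrix_vector_mult_def)

lemma inner_self_block_vec:
  fixes blk :: "'n::finite \<Rightarrow> 's::finite"
  shows "v \<bullet> v = (\<Sum>i\<in>UNIV. block_vec blk i v \<bullet> block_vec blk i v)"
proof -
  have "(\<Sum>i\<in>UNIV. block_vec blk i v \<bullet> block_vec blk i v) =
      (\<Sum>i\<in>UNIV. \<Sum>a\<in>UNIV. if blk a = i then v $ a * v $ a else 0)"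
    by (simp add: inner_vec_def if_distrib cong: if_cong)
  also have "\<dots> = (\<Sum>a\<in>UNIV. \<Sum>i\<in>UNIV. if blk a = i then v $ a * v $ a else 0)"
    by (rule sum.swap)
  finally show ?thesis by (simp add: inner_vec_def)
qed

text \<open>The first-order condition at a minimum, for a quadratic polynomial in one variable.\<close>

lemma linear_coefficient_zero:
  fixes a b :: real
  assumes "\<And>t. 0 \<le> 2 * t * a + t\<^sup>2 * b"
  shows "a = 0"
proof (rule ccontr)
  assume "a \<noteq> 0"
  have b: "0 \<le> 2 * a + b" "0 \<le> - 2 * a + b" using assms[of 1] assms[of "-1"] by simp_all
  then have "0 \<le> b" by simp
  define t where "t = - a / (b + 1)"
  have a: "a = - t * (b + 1)" using \<open>0 \<le> b\<close> by (simp add: t_def)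
  then have "t \<noteq> 0" using \<open>a \<noteq> 0\<close> by auto
  have "2 * t * a + t\<^sup>2 * b = - (t\<^sup>2 * (b + 2))"
    by (subst a) (simp add: algebra_simps power2_eq_square)
  also have "\<dots> < 0" using \<open>0 \<le> b\<close> \<open>t \<noteq> 0\<close> by simp
  finally show False using assms[of t] by simp
qed

text \<open>Eigenvectors of a symmetric matrix for distinct eigenvalues are orthogonal, hence linearly
  independent. Finiteness makes the minimum of the set of singular values meaningful.\<close>

lemma finite_block_singular_values:
  "finite (block_singular_values blk ublk i X)"
proof -
  define Y where "Y = block_row blk i (block_col ublk i X)"
  define W where "W = transpose Y ** Y"
  have W: "transpose W = W" by (simp add: W_def matrix_transpose_mul)
  let ?S = "block_singular_values blk ublk i X"
  have "\<exists>v. v \<noteq> 0 \<and> W *v v = s\<^sup>2 *\<^sub>R v" if "s \<in> ?S" for s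
    using that by (auto simp: block_singular_values_def Let_def W_def Y_def)
  then obtain f where f: "\<And>s. s \<in> ?S \<Longrightarrow> f s \<noteq> 0" "\<And>s. s \<in> ?S \<Longrightarrow> W *v f s = s\<^sup>2 *\<^sub>R f s"
    by metis
  have nonneg: "0 \<le> s" if "s \<in> ?S" for s
    using that by (simp add: block_singular_values_def Let_def)
  have orth: "f s \<bullet> f t = 0" if "s \<in> ?S" "t \<in> ?S" "s \<noteq> t" for s t
  proof -
    have "s\<^sup>2 * (f s \<bullet> f t) = f t \<bullet> (W *v f s)"
      by (simp add: f(2)[OF that(1)] inner_commute[of "f t"])
    also have "\<dots> = f s \<bullet> (W *v f t)" by (rule inner_symmetric_matrix[OF W])
    also have "\<dots> = t\<^sup>2 * (f s \<bullet> f t)" by (simp add: f(2)[OF that(2)])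
    finally have "s\<^sup>2 * (f s \<bullet> f t) = t\<^sup>2 * (f s \<bullet> f t)" .
    moreover have "s\<^sup>2 \<noteq> t\<^sup>2" using that nonneg by (simp add: power2_eq_iff_nonneg)
    ultimately show ?thesis by simp
  qed
  have inj: "inj_on f ?S"
  proof (rule inj_onI, rule ccontr)
    fix s t assume st: "s \<in> ?S" "t \<in> ?S" "f s = f t" "s \<noteq> t"
    then have "f s \<bullet> f s = 0" using orth[of s t] by simp
    then show False using f(1)[OF st(1)] by simp
  qed
  have "pairwise orthogonal (f ` ?S)"
    unfolding pairwise_def orthogonal_def using orth by (auto simp del: inner_eq_zero_iff)
  then have "independent (f ` ?S)"
    by (rule pairwise_orthogonal_independent) (use f(1) in auto)
  then have "finite (f ` ?S)" by (rule independent_imp_finite)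
  then show ?thesis using inj by (rule finite_imageD)
qed

text \<open>The minimum of \<open>|X v|\<^sup>2\<close> over the unit vectors \<open>v\<close> supported on block \<open>i\<close> is attained at an
  eigenvector of \<open>X\<^sup>T X\<close>, and its square root is therefore one of the singular values.\<close>

lemma min_block_singular_value_bound:
  fixes X :: "real^'m^'n"
  assumes v: "\<And>b. ublk b \<noteq> i \<Longrightarrow> v $ b = 0"
  shows "min_block_singular_value blk ublk i X * norm v
    \<le> norm (block_row blk i (block_col ublk i X) *v v)"
proof (cases "v = 0")
  case False
  define Y where "Y = block_row blk i (block_col ublk i X)"
  define V where "V = {v :: real^'m. \<forall>b. ublk b \<noteq> i \<longrightarrow> v $ b = 0}"
  define f where "f v = (Y *v v) \<bullet> (Y *v v)" for v
  have V_scale: "c *\<^sub>R w \<in> V" if "w \<in> V" for c w using that by (auto simp: V_def)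
  have V_add: "w + w' \<in> V" if "w \<in> V" "w' \<in> V" for w w' using that by (auto simp: V_def)
  have "closed V"
  proof -
    have "V = (\<Inter>b\<in>{b. ublk b \<noteq> i}. {v. v $ b = 0})" by (auto simp: V_def)
    also have "closed \<dots>"
      by (intro closed_INT ballI closed_Collect_eq continuous_intros)
    finally show ?thesis .
  qed
  then have cpt: "compact (sphere 0 1 \<inter> V)" by (intro compact_Int_closed) auto
  have ne: "sphere 0 1 \<inter> V \<noteq> {}"
  proof -
    have "(1 / norm v) *\<^sub>R v \<in> sphere 0 1 \<inter> V"
      using v False by (simp add: V_def)
    then show ?thesis by blast
  qed
  have "continuous_on (sphere 0 1 \<inter> V) f"
    unfolding f_def by (intro continuous_intros linear_continuous_on) simp
  from continuous_attains_inf[OF cpt ne this]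
  obtain v0 where v0: "norm v0 = 1" "v0 \<in> V"
    and min: "\<And>w. norm w = 1 \<Longrightarrow> w \<in> V \<Longrightarrow> f v0 \<le> f w" by auto
  have f_scale: "f (c *\<^sub>R w) = c\<^sup>2 * f w" for c w
    by (simp add: f_def matrix_vector_mult_scaleR power2_eq_square)
  have ray: "f v0 * (w \<bullet> w) \<le> f w" if "w \<in> V" for w
  proof (cases "w = 0")
    case False
    have "f v0 \<le> f ((1 / norm w) *\<^sub>R w)" by (rule min) (use False V_scale[OF that] in auto)
    also have "\<dots> = f w / (w \<bullet> w)"
      by (simp add: f_scale power2_norm_eq_inner[symmetric] power_divide)
    finally show ?thesis using False by (simp add: field_simps)
  qed (simp add: f_def)
  \<comment> \<open>Stationarity of the Rayleigh quotient at the minimizer, tested against block vectors.\<close>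
  have stat: "(Y *v v0) \<bullet> (Y *v w) = f v0 * (v0 \<bullet> w)" if w: "w \<in> V" for w
  proof -
    have "0 \<le> 2 * t * ((Y *v v0) \<bullet> (Y *v w) - f v0 * (v0 \<bullet> w)) + t\<^sup>2 * (f w - f v0 * (w \<bullet> w))" for t
    proof -
      have v0_sq: "(v0 + t *\<^sub>R w) \<bullet> (v0 + t *\<^sub>R w) = 1 + 2 * t * (v0 \<bullet> w) + t\<^sup>2 * (w \<bullet> w)"
        using v0(1) by (simp add: inner_add_left inner_add_right inner_commute norm_eq_1 power2_eq_square)
      have "f v0 * ((v0 + t *\<^sub>R w) \<bullet> (v0 + t *\<^sub>R w)) \<le> f (v0 + t *\<^sub>R w)"
        by (rule ray) (intro V_add V_scale w v0)
      then have "f v0 * (1 + 2 * t * (v0 \<bullet> w) + t\<^sup>2 * (w \<bullet> w)) \<le> f (v0 + t *\<^sub>R w)"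
        unfolding v0_sq .
      moreover have "f (v0 + t *\<^sub>R w) = f v0 + 2 * t * ((Y *v v0) \<bullet> (Y *v w)) + t\<^sup>2 * f w"
        unfolding f_def
        by (simp add: matrix_vector_right_distrib matrix_vector_mult_scaleR inner_add_left
            inner_add_right inner_commute power2_eq_square)
      ultimately show ?thesis by (simp add: algebra_simps)
    qed
    then have "(Y *v v0) \<bullet> (Y *v w) - f v0 * (v0 \<bullet> w) = 0" by (rule linear_coefficient_zero)
    then show ?thesis by simp
  qed
  define w where "w = (transpose Y ** Y) *v v0 - f v0 *\<^sub>R v0"
  have YV: "transpose Y *v y \<in> V" for y
    unfolding V_def Y_def
    by (auto simp: block_row_def block_col_def transpose_def matrix_vector_mult_def
        simp del: transpose_matrix_vector vector_transpose_matrix intro!: sum.neutral)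
  have wV: "w \<in> V"
    unfolding w_def using V_add[OF YV V_scale[OF v0(2), of "- f v0"], of "Y *v v0"]
    by (simp add: matrix_vector_mul_assoc[symmetric] del: transpose_matrix_vector vector_transpose_matrix)
  have "w \<bullet> w = (Y *v v0) \<bullet> (Y *v w) - f v0 * (v0 \<bullet> w)"
    using inner_matrix_vector[of "Y *v v0" Y w]
    by (subst w_def) (simp add: inner_diff_left matrix_vector_mul_assoc[symmetric]
        del: transpose_matrix_vector vector_transpose_matrix)
  then have "w = 0" using stat[OF wV] by simp
  have f0: "0 \<le> f v0" by (simp add: f_def)
  have "sqrt (f v0) \<in> block_singular_values blk ublk i X"
    unfolding block_singular_values_def Let_def Y_def[symmetric]
    using \<open>w = 0\<close> v0 f0 by (auto simp: w_def V_def intro!: exI[of _ v0])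
  then have "min_block_singular_value blk ublk i X \<le> sqrt (f v0)"
    unfolding min_block_singular_value_def by (intro Min_le finite_block_singular_values)
  then have "min_block_singular_value blk ublk i X * norm v \<le> sqrt (f v0) * norm v"
    by (intro mult_right_mono) auto
  also have "\<dots> = sqrt (f v0 * (v \<bullet> v))" by (simp add: real_sqrt_mult norm_eq_sqrt_inner)
  also have "\<dots> \<le> sqrt (f v)" using ray[of v] v by (simp add: V_def)
  also have "\<dots> = norm (Y *v v)" by (simp add: f_def norm_eq_sqrt_inner)
  finally show ?thesis by (simp add: Y_def)
qed simp

lemma block_diagonal_mult_block_vec:
  fixes B :: "real^'m^'n"
  assumes "block_diagonal blk ublk B"
  shows "B *v block_vec ublk i v = block_vec blk i (B *v v)"
  using assms unfolding block_diagonal_def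
  by (auto simp: vec_eq_iff matrix_vector_mult_def intro!: sum.cong sum.neutral)

lemma block_diagonal_norm_bound:
  fixes B :: "real^'m^'n" and blk :: "'n::finite \<Rightarrow> 's::finite"
  assumes B: "block_diagonal blk ublk B" and "0 < \<epsilon>"
    and min: "\<And>i. \<epsilon> \<le> min_block_singular_value blk ublk i B"
  shows "\<epsilon> * norm v \<le> norm (B *v v)"
proof -
  have "\<epsilon> * norm (block_vec ublk i v) \<le> norm (block_vec blk i (B *v v))" for i
  proof -
    have "\<epsilon> * norm (block_vec ublk i v) \<le> min_block_singular_value blk ublk i B * norm (block_vec ublk i v)"
      using min by (intro mult_right_mono) auto
    also have "\<dots> \<le> norm (block_row blk i (block_col ublk i B) *v block_vec ublk i v)"
      by (rule min_block_singular_value_bound) simp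
    also have "block_row blk i (block_col ublk i B) *v block_vec ublk i v = block_vec blk i (B *v v)"
      using B unfolding block_diagonal_def
      by (auto simp: vec_eq_iff block_row_def block_col_def matrix_vector_mult_def intro!: sum.cong sum.neutral)
    finally show ?thesis .
  qed
  then have "(\<epsilon> * norm (block_vec ublk i v))\<^sup>2 \<le> (norm (block_vec blk i (B *v v)))\<^sup>2" for i
    using \<open>0 < \<epsilon>\<close> by (intro power_mono) auto
  then have "\<epsilon>\<^sup>2 * (block_vec ublk i v \<bullet> block_vec ublk i v)
      \<le> block_vec blk i (B *v v) \<bullet> block_vec blk i (B *v v)" for i
    by (simp add: power_mult_distrib power2_norm_eq_inner)
  then have "\<epsilon>\<^sup>2 * (v \<bullet> v) \<le> (B *v v) \<bullet> (B *v v)"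
    unfolding inner_self_block_vec[of v ublk] inner_self_block_vec[of "B *v v" blk] sum_distrib_left
    by (intro sum_mono)
  then have "(\<epsilon> * norm v)\<^sup>2 \<le> (norm (B *v v))\<^sup>2"
    by (simp add: power_mult_distrib power2_norm_eq_inner)
  then show ?thesis by (rule power2_le_imp_le) simp
qed

lemma block_diagonal_inverse:
  fixes B :: "real^'m^'n" and blk :: "'n::finite \<Rightarrow> 's::finite" and ublk :: "'m::finite \<Rightarrow> 's"
  assumes B: "block_diagonal blk ublk B" and card: "\<And>i. card {b. ublk b = i} = card {a. blk a = i}"
    and "0 < \<epsilon>" and min: "\<And>i. \<epsilon> \<le> min_block_singular_value blk ublk i B"
  obtains D :: "real^'n^'m" where "B ** D = mat 1" "D ** B = mat 1"
    "\<And>z. \<epsilon> * norm (D *v z) \<le> norm z" "block_diagonal ublk blk D"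
proof -
  note bound = block_diagonal_norm_bound[OF B \<open>0 < \<epsilon>\<close> min]
  have fibres: "CARD('a) = (\<Sum>i\<in>UNIV. card {a. g a = i})" for g :: "'a::finite \<Rightarrow> 's"
    using sum.group[of UNIV UNIV g "\<lambda>_. 1 :: nat"] by simp
  \<comment> \<open>Counting coordinates subsystem by subsystem shows that \<open>B\<close> is square.\<close>
  have "CARD('m) = CARD('n)" using fibres[of ublk] fibres[of blk] card by simp
  have inj: "inj ((*v) B)"
  proof (rule injI)
    fix x y assume "B *v x = B *v y"
    then have "\<epsilon> * norm (x - y) \<le> 0" using bound[of "x - y"] by (simp add: matrix_vector_mult_diff_distrib)
    then show "x = y" using \<open>0 < \<epsilon>\<close> by (simp add: mult_le_0_iff)
  qed
  have "surj ((*v) B)"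
    by (rule linear_injective_imp_surjective) (use inj \<open>CARD('m) = CARD('n)\<close> in simp_all)
  then obtain D where BD: "B ** D = mat 1" by (auto simp: matrix_right_invertible_surjective[symmetric])
  have BDz: "B *v (D *v z) = z" for z by (simp add: matrix_vector_mul_assoc BD)
  have DBv: "D *v (B *v v) = v" for v using inj BDz[of "B *v v"] by (simp add: inj_eq)
  then have DB: "D ** B = mat 1" by (simp add: matrix_eq matrix_vector_mul_assoc)
  have "\<epsilon> * norm (D *v z) \<le> norm z" for z using bound[of "D *v z"] by (simp add: BDz)
  moreover have "block_diagonal ublk blk D"
    unfolding block_diagonal_def
  proof (intro allI impI)
    fix b a assume "ublk b \<noteq> blk a"
    have "B *v block_vec ublk (ublk b) (D *v axis a 1) = block_vec blk (ublk b) (axis a 1)"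
      by (simp add: block_diagonal_mult_block_vec[OF B] BDz)
    also have "\<dots> = 0" using \<open>ublk b \<noteq> blk a\<close> by (auto simp: vec_eq_iff axis_def)
    finally have "block_vec ublk (ublk b) (D *v axis a 1) = 0"
      using DBv[of "block_vec ublk (ublk b) (D *v axis a 1)"] by simp
    then have "(D *v axis a 1) $ b = 0" by (metis (full_types) block_vec_nth zero_index)
    then show "D $ b $ a = 0" by (simp add: matrix_vector_mult_basis column_def)
  qed
  ultimately show thesis using that BD DB by blast
qed

text \<open>The pointwise inequality behind the performance bound. With \<open>a = |y + B u|\<close> and \<open>b = |u|\<close>, one has
  \<open>|D y| \<le> a/\<epsilon> + b\<close>, and \<open>(1 + 1/\<epsilon>\<^sup>2) (a\<^sup>2 + b\<^sup>2) - (a/\<epsilon> + b)\<^sup>2 = (a - b/\<epsilon>)\<^sup>2\<close>.\<close>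

lemma inverse_input_bound:
  fixes B :: "real^'m^'n" and D :: "real^'n^'m"
  assumes DB: "D ** B = mat 1" and "0 < \<epsilon>" and D: "\<And>z. \<epsilon> * norm (D *v z) \<le> norm z"
  shows "(D *v y) \<bullet> (D *v y) \<le> (1 + 1/\<epsilon>\<^sup>2) * (u \<bullet> u + (y + B *v u) \<bullet> (y + B *v u))"
proof -
  let ?a = "norm (y + B *v u)" and ?b = "norm u"
  have "D *v y = D *v (y + B *v u) - u"
    by (simp add: matrix_vector_right_distrib matrix_vector_mul_assoc DB)
  then have "norm (D *v y) \<le> norm (D *v (y + B *v u)) + ?b" by (metis norm_triangle_ineq4)
  also have "norm (D *v (y + B *v u)) \<le> ?a / \<epsilon>"
    using D[of "y + B *v u"] \<open>0 < \<epsilon>\<close> by (simp add: field_simps)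
  finally have "(norm (D *v y))\<^sup>2 \<le> (?a / \<epsilon> + ?b)\<^sup>2" by (intro power_mono) auto
  also have "\<dots> \<le> (?a / \<epsilon> + ?b)\<^sup>2 + (?a - ?b / \<epsilon>)\<^sup>2" by simp
  also have "\<dots> = (1 + 1/\<epsilon>\<^sup>2) * (?b\<^sup>2 + ?a\<^sup>2)"
    using \<open>0 < \<epsilon>\<close> by (simp add: field_simps power2_eq_square)
  finally show ?thesis by (simp add: power2_norm_eq_inner)
qed

section \<open>Second moments of independent block rows\<close>

lemma sum_block_row:
  fixes blk :: "'n::finite \<Rightarrow> 's::finite"
  shows "(\<Sum>i\<in>UNIV. block_row blk i Z) = Z"
  by (simp add: vec_eq_iff block_row_def)

lemma bounded_linear_block_row: "bounded_linear (block_row blk i :: real^'c^'n \<Rightarrow> _)"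
  by (intro linear_conv_bounded_linear[THEN iffD1] linearI)
    (simp_all add: vec_eq_iff block_row_def)

lemma bounded_linear_matrix_entry: "bounded_linear (\<lambda>X :: real^'a^'b. X $ a $ c)"
  by (intro bounded_linear_compose[OF bounded_linear_vec_nth] bounded_linear_vec_nth)

lemma integrable_matrixI:
  fixes X :: "'w \<Rightarrow> real^'a^'b"
  assumes "\<And>a b. integrable M (\<lambda>\<omega>. X \<omega> $ a $ b)"
  shows "integrable M X"
proof -
  have "(\<lambda>\<omega>. \<Sum>a\<in>UNIV. \<Sum>b\<in>UNIV. (X \<omega> $ a $ b) *\<^sub>R axis a (axis b 1)) = X"
  proof -
    have delta: "(\<Sum>b\<in>UNIV. if i = a then if j = b then X \<omega> $ a $ b else 0 else 0) =
        (if i = a then X \<omega> $ a $ j else 0)" for \<omega> i j a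
      by simp
    show ?thesis
      unfolding fun_eq_iff vec_eq_iff
      by (simp add: axis_def if_distrib[of "\<lambda>x. x $ _"] if_distrib[of "\<lambda>x. _ * x"] delta cong: if_cong)
  qed
  moreover have "integrable M (\<lambda>\<omega>. \<Sum>a\<in>UNIV. \<Sum>b\<in>UNIV. (X \<omega> $ a $ b) *\<^sub>R axis a (axis b 1 :: real^'a))"
    by (intro Bochner_Integration.integrable_sum integrable_scaleR_left assms)
  ultimately show ?thesis by simp
qed

lemma measurable_matrix_entry: "(\<lambda>X :: real^'a^'b. X $ a $ c) \<in> borel_measurable borel"
  by (intro borel_measurable_continuous_onI continuous_intros)

lemma integral_matrix_entry:
  fixes X :: "'w \<Rightarrow> real^'a^'b"
  assumes "integrable M X"
  shows "(\<integral>\<omega>. X \<omega> \<partial>M) $ a $ b = (\<integral>\<omega>. X \<omega> $ a $ b \<partial>M)"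
  using integral_bounded_linear[OF bounded_linear_matrix_entry assms, of a b] by simp

lemma integral_matrix_form:
  fixes X :: "'w \<Rightarrow> real^'n^'n"
  assumes "integrable M X"
  shows "x \<bullet> ((\<integral>\<omega>. X \<omega> \<partial>M) *v x) = (\<integral>\<omega>. x \<bullet> (X \<omega> *v x) \<partial>M)"
proof -
  have "bounded_linear (\<lambda>Y :: real^'n^'n. x \<bullet> (Y *v x))"
    by (intro linear_conv_bounded_linear[THEN iffD1] linearI)
      (simp_all add: matrix_vector_mult_add_rdistrib inner_add_right
        scaleR_matrix_vector_assoc[symmetric])
  from integral_bounded_linear[OF this assms] show ?thesis by simp
qed

lemma congruence_entry:
  fixes X :: "real^'c^'n"
  shows "(transpose X ** S ** X) $ c $ d = (\<Sum>a\<in>UNIV. \<Sum>b\<in>UNIV. S $ a $ b * (X $ a $ c * X $ b $ d))"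
proof -
  have "(transpose X ** S ** X) $ c $ d = (\<Sum>b\<in>UNIV. \<Sum>a\<in>UNIV. S $ a $ b * (X $ a $ c * X $ b $ d))"
    by (simp add: matrix_matrix_mult_def transpose_def sum_distrib_right sum_distrib_left ac_simps)
  also have "\<dots> = (\<Sum>a\<in>UNIV. \<Sum>b\<in>UNIV. S $ a $ b * (X $ a $ c * X $ b $ d))" by (rule sum.swap)
  finally show ?thesis .
qed

lemma congruence_form:
  fixes X :: "real^'c^'n"
  shows "x \<bullet> ((transpose X ** S ** X) *v x) = (X *v x) \<bullet> (S *v (X *v x))"
  by (simp add: matrix_vector_mul_assoc[symmetric] inner_matrix_vector
      del: transpose_matrix_vector vector_transpose_matrix)

text \<open>A random sequence of system matrices with mutually independent block rows and time-invariant
  first and second moments.\<close>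

locale block_system = prob_space M for M :: "'w measure" +
  fixes blk :: "'n::finite \<Rightarrow> 's::finite"
    and A :: "nat \<Rightarrow> 'w \<Rightarrow> real^'n^'n" and Abar :: "real^'n^'n"
    and \<Sigma> :: "real^('n \<times> 'n)^('n \<times> 'n)"
  assumes indep_rows: "indep_vars (\<lambda>_. borel) (\<lambda>(k, i) \<omega>. block_row blk i (A k \<omega>)) UNIV"
    and integrable_A: "\<And>k. integrable M (A k)"
    and integrable_kronecker: "\<And>k. integrable M (\<lambda>\<omega>. kronecker (A k \<omega>) (A k \<omega>))"
    and mean_A: "\<And>k. integral\<^sup>L M (A k) = Abar"
    and second_moment_A: "\<And>k. (\<integral>\<omega>. kronecker (A k \<omega>) (A k \<omega>) \<partial>M) = \<Sigma>"
begin

abbreviation "At \<equiv> Atilde M blk A"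

lemma measurable_A [measurable]: "A k \<in> borel_measurable M"
  using integrable_A by auto

lemma Atilde_entry: "At i k \<omega> $ a $ c = (if blk a = i then A k \<omega> $ a $ c - Abar $ a $ c else 0)"
  by (simp add: Atilde_def block_row_def mean_A)

lemma A_eq_mean_plus_Atilde: "A k \<omega> = Abar + (\<Sum>i\<in>UNIV. At i k \<omega>)"
  by (simp add: Atilde_def sum_block_row mean_A)

lemma entry_integrable: "integrable M (\<lambda>\<omega>. A k \<omega> $ a $ c)"
  by (rule integrable_bounded_linear[OF bounded_linear_matrix_entry integrable_A])

lemma entry_mean: "(\<integral>\<omega>. A k \<omega> $ a $ c \<partial>M) = Abar $ a $ c"
  using integral_matrix_entry[OF integrable_A[of k], of a c] by (simp add: mean_A)

lemma entry_product_integrable: "integrable M (\<lambda>\<omega>. A k \<omega> $ a $ c * A k \<omega> $ b $ d)"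
  using integrable_bounded_linear[OF bounded_linear_matrix_entry[of "(a, b)" "(c, d)"]
      integrable_kronecker[of k]]
  by (simp add: kronecker_def)

lemma entry_product_mean: "(\<integral>\<omega>. A k \<omega> $ a $ c * A k \<omega> $ b $ d \<partial>M) = \<Sigma> $ (a, b) $ (c, d)"
  using integral_matrix_entry[OF integrable_kronecker[of k], of "(a, b)" "(c, d)"]
  by (simp add: second_moment_A) (simp add: kronecker_def)

lemma Atilde_entry_integrable: "integrable M (\<lambda>\<omega>. At i k \<omega> $ a $ c)"
  unfolding Atilde_entry using entry_integrable by (cases "blk a = i") simp_all

lemma Atilde_entry_mean: "(\<integral>\<omega>. At i k \<omega> $ a $ c \<partial>M) = 0"
  unfolding Atilde_entry using entry_integrable[of k a c]
  by (cases "blk a = i") (simp_all add: entry_mean prob_space)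

lemma Atilde_entry_product_integrable:
  "integrable M (\<lambda>\<omega>. At i k \<omega> $ a $ c * At j k \<omega> $ b $ d)"
proof -
  have "integrable M (\<lambda>\<omega>. (A k \<omega> $ a $ c - Abar $ a $ c) * (A k \<omega> $ b $ d - Abar $ b $ d))"
    unfolding left_diff_distrib right_diff_distrib
    using entry_product_integrable entry_integrable by simp
  then show ?thesis
    unfolding Atilde_entry by (cases "blk a = i"; cases "blk b = j") simp_all
qed

lemma Atilde_entry_product_mean:
  "(\<integral>\<omega>. At i k \<omega> $ a $ c * At j k \<omega> $ b $ d \<partial>M) =
    (if blk a = i \<and> blk b = j then \<Sigma> $ (a, b) $ (c, d) - Abar $ a $ c * Abar $ b $ d else 0)"
proof -
  have "(\<integral>\<omega>. (A k \<omega> $ a $ c - Abar $ a $ c) * (A k \<omega> $ b $ d - Abar $ b $ d) \<partial>M) =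
      \<Sigma> $ (a, b) $ (c, d) - Abar $ a $ c * Abar $ b $ d"
    unfolding left_diff_distrib right_diff_distrib
    using entry_product_integrable entry_integrable
    by (simp add: entry_mean entry_product_mean prob_space)
  then show ?thesis
    unfolding Atilde_entry by (cases "blk a = i"; cases "blk b = j") simp_all
qed

text \<open>Distinct block rows at the same time are independent and have zero mean after centring.\<close>

lemma Atilde_uncorrelated:
  assumes "i \<noteq> j"
  shows "(\<integral>\<omega>. At i k \<omega> $ a $ c * At j k \<omega> $ b $ d \<partial>M) = 0"
proof -
  let ?X = "\<lambda>p \<omega>. block_row blk (snd p) (A (fst p) \<omega>)"
  have ind: "indep_vars (\<lambda>_. borel) ?X UNIV"
    using indep_rows by (simp add: case_prod_unfold)
  have "indep_var (PiM {(k, i)} (\<lambda>_. borel)) (\<lambda>\<omega>. restrict (\<lambda>p. ?X p \<omega>) {(k, i)})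
      (PiM {(k, j)} (\<lambda>_. borel)) (\<lambda>\<omega>. restrict (\<lambda>p. ?X p \<omega>) {(k, j)})"
    by (rule indep_var_restrict[OF ind]) (use assms in auto)
  then have "indep_var
      borel ((\<lambda>h. (if blk a = i then h (k, i) $ a $ c - Abar $ a $ c else 0)) \<circ>
        (\<lambda>\<omega>. restrict (\<lambda>p. ?X p \<omega>) {(k, i)}))
      borel ((\<lambda>h. (if blk b = j then h (k, j) $ b $ d - Abar $ b $ d else 0)) \<circ>
        (\<lambda>\<omega>. restrict (\<lambda>p. ?X p \<omega>) {(k, j)}))"
    by (rule indep_var_compose)
      (cases "blk a = i"; cases "blk b = j"; auto intro!: borel_measurable_diff
        measurable_compose[OF _ measurable_matrix_entry] measurable_component_singleton)+
  moreover have "(\<lambda>h. (if blk a = i then h (k, i) $ a $ c - Abar $ a $ c else 0)) \<circ>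
        (\<lambda>\<omega>. restrict (\<lambda>p. ?X p \<omega>) {(k, i)}) = (\<lambda>\<omega>. At i k \<omega> $ a $ c)"
    by (auto simp: fun_eq_iff Atilde_entry block_row_def)
  moreover have "(\<lambda>h. (if blk b = j then h (k, j) $ b $ d - Abar $ b $ d else 0)) \<circ>
        (\<lambda>\<omega>. restrict (\<lambda>p. ?X p \<omega>) {(k, j)}) = (\<lambda>\<omega>. At j k \<omega> $ b $ d)"
    by (auto simp: fun_eq_iff Atilde_entry block_row_def)
  ultimately have "indep_var borel (\<lambda>\<omega>. At i k \<omega> $ a $ c) borel (\<lambda>\<omega>. At j k \<omega> $ b $ d)"
    by simp
  then show ?thesis
    by (subst indep_var_lebesgue_integral) (simp_all add: Atilde_entry_integrable Atilde_entry_mean)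
qed

lemma linear_form_Atilde:
  "integrable M (\<lambda>\<omega>. l \<bullet> (At i k \<omega> *v x))" "(\<integral>\<omega>. l \<bullet> (At i k \<omega> *v x) \<partial>M) = 0"
  unfolding inner_matrix_vector_sum
  using Atilde_entry_integrable by (simp_all add: Atilde_entry_mean)

lemma bilinear_form_Atilde_eq:
  "(At i k \<omega> *v x) \<bullet> (N *v (At j k \<omega> *v x)) =
    (\<Sum>a\<in>UNIV. \<Sum>b\<in>UNIV. N $ a $ b * (\<Sum>c\<in>UNIV. \<Sum>d\<in>UNIV. x $ c * x $ d * (At i k \<omega> $ a $ c * At j k \<omega> $ b $ d)))"
  unfolding inner_matrix_vector_sum
  by (simp add: matrix_vector_mult_def sum_product ac_simps)

lemma bilinear_form_Atilde_integrable:
  "integrable M (\<lambda>\<omega>. (At i k \<omega> *v x) \<bullet> (N *v (At j k \<omega> *v x)))"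
  unfolding bilinear_form_Atilde_eq
  by (intro Bochner_Integration.integrable_sum integrable_mult_right Atilde_entry_product_integrable)

lemma bilinear_form_Atilde_uncorrelated:
  assumes "i \<noteq> j"
  shows "(\<integral>\<omega>. (At i k \<omega> *v x) \<bullet> (N *v (At j k \<omega> *v x)) \<partial>M) = 0"
  unfolding bilinear_form_Atilde_eq
  using Atilde_entry_product_integrable by (simp add: Atilde_uncorrelated[OF assms])

text \<open>For zero-mean uncorrelated vectors \<open>v\<^sub>i = At i k \<omega> x\<close>, the expectation of a quadratic form of
  \<open>L\<^sub>0 y + \<Sum>\<^sub>i L\<^sub>i v\<^sub>i\<close> is the sum of its values on the individual terms: all mixed terms
  have zero mean.\<close>

lemma second_moment_decouples:
  fixes x y and k and L0 :: "real^'n^'q" and L :: "'s \<Rightarrow> real^'n^'q" and W :: "real^'q^'q"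
  defines "z \<equiv> \<lambda>\<omega>. L0 *v y + (\<Sum>i\<in>UNIV. L i *v (At i k \<omega> *v x))"
  shows "integrable M (\<lambda>\<omega>. z \<omega> \<bullet> (W *v z \<omega>))" (is ?int)
    and "(\<integral>\<omega>. z \<omega> \<bullet> (W *v z \<omega>) \<partial>M) = (L0 *v y) \<bullet> (W *v (L0 *v y)) +
      (\<Sum>i\<in>UNIV. \<integral>\<omega>. (L i *v (At i k \<omega> *v x)) \<bullet> (W *v (L i *v (At i k \<omega> *v x))) \<partial>M)" (is ?eq)
proof -
  let ?p = "L0 *v y"
  let ?v = "\<lambda>i \<omega>. At i k \<omega> *v x"
  define N where "N i j = transpose (L i) ** W ** L j" for i j
  define l where "l i = transpose (L i) *v (W *v ?p) + transpose (L i) *v (transpose W *v ?p)" for i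
  have cross: "(L i *v v) \<bullet> (W *v (L j *v w)) = v \<bullet> (N i j *v w)" for i j v w
    unfolding N_def by (simp add: matrix_vector_mul_assoc[symmetric] inner_matrix_vector
      del: transpose_matrix_vector vector_transpose_matrix)
  have lin: "(L i *v v) \<bullet> (W *v ?p) + ?p \<bullet> (W *v (L i *v v)) = l i \<bullet> v" for i v
    unfolding l_def
    using inner_matrix_vector[of "W *v ?p" "L i" v] inner_matrix_vector[of "transpose W *v ?p" "L i" v]
      inner_matrix_vector[of ?p W "L i *v v"]
    by (simp only: inner_add_left inner_commute[of "L i *v v"])
  have z: "z \<omega> \<bullet> (W *v z \<omega>) = ?p \<bullet> (W *v ?p) + (\<Sum>i\<in>UNIV. l i \<bullet> ?v i \<omega>) +
      (\<Sum>i\<in>UNIV. \<Sum>j\<in>UNIV. ?v i \<omega> \<bullet> (N i j *v ?v j \<omega>))" for \<omega>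
  proof -
    let ?s = "\<Sum>i\<in>UNIV. L i *v ?v i \<omega>"
    have "?s \<bullet> (W *v ?p) + ?p \<bullet> (W *v ?s) = (\<Sum>i\<in>UNIV. l i \<bullet> ?v i \<omega>)"
      by (simp add: inner_sum_left inner_sum_right linear_sum[OF matrix_vector_mul_linear] sum.distrib[symmetric] lin)
    moreover have "?s \<bullet> (W *v ?s) = (\<Sum>i\<in>UNIV. \<Sum>j\<in>UNIV. ?v i \<omega> \<bullet> (N i j *v ?v j \<omega>))"
      by (simp add: inner_sum_left inner_sum_right linear_sum[OF matrix_vector_mul_linear] cross)
        (rule sum.swap)
    ultimately show ?thesis
      unfolding z_def by (simp add: matrix_vector_right_distrib inner_add_left inner_add_right)
  qed
  show ?int unfolding z
    by (intro Bochner_Integration.integrable_add Bochner_Integration.integrable_sum integrable_const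
        linear_form_Atilde bilinear_form_Atilde_integrable)
  have "(\<integral>\<omega>. z \<omega> \<bullet> (W *v z \<omega>) \<partial>M) = ?p \<bullet> (W *v ?p) + (\<Sum>i\<in>UNIV. \<integral>\<omega>. l i \<bullet> ?v i \<omega> \<partial>M) +
      (\<Sum>i\<in>UNIV. \<Sum>j\<in>UNIV. \<integral>\<omega>. ?v i \<omega> \<bullet> (N i j *v ?v j \<omega>) \<partial>M)"
    unfolding z using linear_form_Atilde(1) bilinear_form_Atilde_integrable
    by (simp add: prob_space)
  also have "(\<Sum>i\<in>UNIV. \<integral>\<omega>. l i \<bullet> ?v i \<omega> \<partial>M) = 0" by (simp add: linear_form_Atilde(2))
  also have "(\<Sum>i\<in>UNIV. \<Sum>j\<in>UNIV. \<integral>\<omega>. ?v i \<omega> \<bullet> (N i j *v ?v j \<omega>) \<partial>M) =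
      (\<Sum>i\<in>UNIV. \<Sum>j\<in>UNIV. if j = i then \<integral>\<omega>. ?v i \<omega> \<bullet> (N i i *v ?v i \<omega>) \<partial>M else 0)"
    by (intro sum.cong refl) (auto simp: bilinear_form_Atilde_uncorrelated)
  finally show ?eq by (simp add: cross)
qed

lemma riccati_Atilde_integrable:
  "integrable M (\<lambda>\<omega>. riccati (At i k \<omega>) P C (mat 1))"
  unfolding riccati_eq
  by (intro integrable_matrixI)
    (simp only: congruence_entry, intro Bochner_Integration.integrable_sum integrable_mult_right
      Atilde_entry_product_integrable)

lemma riccati_Atilde_integral_indep_time:
  "(\<integral>\<omega>. riccati (At i k \<omega>) P C (mat 1) \<partial>M) = (\<integral>\<omega>. riccati (At i k' \<omega>) P C (mat 1) \<partial>M)"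
proof -
  have "(\<integral>\<omega>. riccati (At i k \<omega>) P C (mat 1) $ c $ d \<partial>M) =
      (\<integral>\<omega>. riccati (At i k' \<omega>) P C (mat 1) $ c $ d \<partial>M)" for c d
    unfolding riccati_eq congruence_entry
    using Atilde_entry_product_integrable by (simp add: Atilde_entry_product_mean)
  then show ?thesis by (simp add: vec_eq_iff integral_matrix_entry[OF riccati_Atilde_integrable])
qed

lemma riccati_Atilde_integral_form:
  "x \<bullet> ((\<integral>\<omega>. riccati (At i k \<omega>) P C (mat 1) \<partial>M) *v x) =
    (\<integral>\<omega>. (At i k \<omega> *v x) \<bullet> (riccati_form P C *v (At i k \<omega> *v x)) \<partial>M)"
  by (subst integral_matrix_form[OF riccati_Atilde_integrable])
    (simp only: riccati_eq congruence_form)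

lemma riccati_Atilde_integral_symmetric:
  assumes "pos_semidef P"
  shows "transpose (\<integral>\<omega>. riccati (At i k \<omega>) P C (mat 1) \<partial>M) = (\<integral>\<omega>. riccati (At i k \<omega>) P C (mat 1) \<partial>M)"
proof -
  have "transpose (riccati (At i k \<omega>) P C (mat 1)) = riccati (At i k \<omega>) P C (mat 1)" for \<omega>
    by (simp add: riccati_eq matrix_transpose_mul riccati_form_symmetric[OF assms] matrix_mul_assoc)
  then have "riccati (At i k \<omega>) P C (mat 1) $ d $ c = riccati (At i k \<omega>) P C (mat 1) $ c $ d" for \<omega> c d
    by (simp add: vec_eq_iff transpose_def)
  then show ?thesis
    by (simp add: vec_eq_iff transpose_def integral_matrix_entry[OF riccati_Atilde_integrable])
qed

end

section \<open>The cost of a linear feedback\<close>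

lemma measurable_matrix_vector_mult:
  fixes X :: "'w \<Rightarrow> real^'a^'b" and v :: "'w \<Rightarrow> real^'a"
  assumes "X \<in> borel_measurable M" "v \<in> borel_measurable M"
  shows "(\<lambda>\<omega>. X \<omega> *v v \<omega>) \<in> borel_measurable M"
  by (rule borel_measurable_continuous_Pair[OF assms])
    (unfold matrix_vector_mult_def, intro continuous_intros)

lemma measurable_matrix_mult:
  fixes X :: "'w \<Rightarrow> real^'a^'b" and Y :: "'w \<Rightarrow> real^'c^'a"
  assumes "X \<in> borel_measurable M" "Y \<in> borel_measurable M"
  shows "(\<lambda>\<omega>. X \<omega> ** Y \<omega>) \<in> borel_measurable M"
  by (rule borel_measurable_continuous_Pair[OF assms])
    (unfold matrix_matrix_mult_def, intro continuous_intros)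

lemma measurable_block_row:
  assumes "X \<in> borel_measurable M"
  shows "(\<lambda>\<omega>. block_row blk i (X \<omega>) :: real^'c^'n) \<in> borel_measurable M"
  by (rule measurable_compose[OF assms borel_measurable_continuous_onI])
    (rule bounded_linear.continuous_on[OF bounded_linear_block_row continuous_on_id])

lemma cost_eq_SUP:
  "cost M A B x0 u =
    (SUP T. \<integral>\<^sup>+\<omega>. ennreal (\<Sum>k<T. state A B x0 u k \<omega> \<bullet> state A B x0 u k \<omega> + u k \<omega> \<bullet> u k \<omega>) \<partial>M)"
proof -
  have "incseq (\<lambda>T. \<integral>\<^sup>+\<omega>. ennreal (\<Sum>k<T. state A B x0 u k \<omega> \<bullet> state A B x0 u k \<omega> + u k \<omega> \<bullet> u k \<omega>) \<partial>M)"
    by (intro incseq_SucI nn_integral_mono ennreal_leI) simp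
  then show ?thesis unfolding cost_def by (intro limI LIMSEQ_SUP)
qed

lemma partial_cost_le_cost:
  "(\<integral>\<^sup>+\<omega>. ennreal (\<Sum>k<T. state A B x0 u k \<omega> \<bullet> state A B x0 u k \<omega> + u k \<omega> \<bullet> u k \<omega>) \<partial>M) \<le> cost M A B x0 u"
  unfolding cost_eq_SUP by (rule SUP_upper) simp

context block_system
begin

lemma state_measurable:
  fixes B :: "real^'m^'n" and g :: "real^'n^'n \<Rightarrow> real^'n^'m"
  assumes g: "g \<in> borel_measurable borel"
  shows "feedback_state A B (\<lambda>k \<omega>. g (A k \<omega>)) x0 k \<in> borel_measurable M"
proof (induction k)
  case (Suc k)
  then show ?case unfolding feedback_state.simps[abs_def]
    by (intro borel_measurable_add measurable_matrix_vector_mult measurable_const measurable_A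
        measurable_compose[OF measurable_A g]) simp_all
qed simp

text \<open>The state \<open>x(k)\<close> is independent of \<open>A(k)\<close>, expressed as a Fubini rule: given \<open>x(k)\<close>, the
  expectation over \<open>A(k)\<close> can be taken separately.\<close>

lemma nn_integral_state_dynamics:
  fixes x0 and k and B :: "real^'m^'n" and g :: "real^'n^'n \<Rightarrow> real^'n^'m"
  assumes g: "g \<in> borel_measurable borel"
    and f: "f \<in> borel_measurable (borel \<Otimes>\<^sub>M borel)"
  defines "x \<equiv> feedback_state A B (\<lambda>k \<omega>. g (A k \<omega>)) x0"
  shows "(\<integral>\<^sup>+\<omega>. f (x k \<omega>, A k \<omega>) \<partial>M) = (\<integral>\<^sup>+\<omega>. \<integral>\<^sup>+\<omega>'. f (x k \<omega>, A k \<omega>') \<partial>M \<partial>M)"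
proof -
  let ?X = "\<lambda>p \<omega>. block_row blk (snd p) (A (fst p) \<omega>)"
  let ?G = "\<lambda>k \<omega>. g (A k \<omega>)"
  let ?past = "{..<k} \<times> (UNIV :: 's set)" and ?now = "{k} \<times> (UNIV :: 's set)"
  \<comment> \<open>\<open>R j\<close> and \<open>\<Phi> j\<close> rebuild the system matrix and the state at time \<open>j\<close> from a family \<open>h\<close> of block rows.\<close>
  define R where "R j h = (\<Sum>i\<in>UNIV. h (j, i))" for j and h :: "nat \<times> 's \<Rightarrow> real^'n^'n"
  define \<Phi> where "\<Phi> = feedback_state R B (\<lambda>j h. g (R j h)) x0"
  have ind: "indep_vars (\<lambda>_. borel) ?X UNIV"
    using indep_rows by (simp add: case_prod_unfold)
  have R_meas: "R j \<in> borel_measurable (PiM I (\<lambda>_. borel))" if "{j} \<times> UNIV \<subseteq> I" for j I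
    unfolding R_def using that by (intro borel_measurable_sum measurable_component_singleton) auto
  have \<Phi>_meas: "\<Phi> j \<in> borel_measurable (PiM ?past (\<lambda>_. borel))" if "j \<le> k" for j
    using that
  proof (induction j)
    case 0
    then show ?case by (simp add: \<Phi>_def)
  next
    case (Suc j)
    have R: "R j \<in> borel_measurable (PiM ?past (\<lambda>_. borel))" using Suc.prems by (intro R_meas) auto
    then have "(\<lambda>h. g (R j h)) \<in> borel_measurable (PiM ?past (\<lambda>_. borel))"
      by (rule measurable_compose[OF _ g])
    then have "(\<lambda>h. R j h *v \<Phi> j h + B *v (g (R j h) *v \<Phi> j h)) \<in> borel_measurable (PiM ?past (\<lambda>_. borel))"
      using R Suc by (intro borel_measurable_add measurable_matrix_vector_mult measurable_const) auto
    then show ?case by (simp add: \<Phi>_def)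
  qed
  have R_past: "R j (restrict (\<lambda>p. ?X p \<omega>) I) = A j \<omega>" if "{j} \<times> UNIV \<subseteq> I" for j \<omega> I
  proof -
    have "R j (restrict (\<lambda>p. ?X p \<omega>) I) = (\<Sum>i\<in>UNIV. block_row blk i (A j \<omega>))"
      unfolding R_def using that by (intro sum.cong) auto
    then show ?thesis by (simp add: sum_block_row)
  qed
  have \<Phi>_past: "\<Phi> j (restrict (\<lambda>p. ?X p \<omega>) ?past) = feedback_state A B ?G x0 j \<omega>" if "j \<le> k" for j \<omega>
    using that
  proof (induction j)
    case (Suc j)
    then have "R j (restrict (\<lambda>p. ?X p \<omega>) ?past) = A j \<omega>" by (intro R_past) auto
    then show ?case using Suc by (simp add: \<Phi>_def del: restrict_apply)
  qed (simp add: \<Phi>_def)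
  let ?S = "PiM ?past (\<lambda>_. borel) :: (nat \<times> 's \<Rightarrow> real^'n^'n) measure"
  let ?T = "PiM ?now (\<lambda>_. borel) :: (nat \<times> 's \<Rightarrow> real^'n^'n) measure"
  let ?p = "\<lambda>\<omega>. restrict (\<lambda>p. ?X p \<omega>) ?past" and ?n = "\<lambda>\<omega>. restrict (\<lambda>p. ?X p \<omega>) ?now"
  have "indep_var ?S ?p ?T ?n"
    by (rule indep_var_restrict[OF ind]) auto
  then have p: "?p \<in> measurable M ?S" and n: "?n \<in> measurable M ?T"
    and prod: "distr M (?S \<Otimes>\<^sub>M ?T) (\<lambda>\<omega>. (?p \<omega>, ?n \<omega>)) = distr M ?S ?p \<Otimes>\<^sub>M distr M ?T ?n"
    by (auto simp: indep_var_distribution_eq)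
  interpret n: prob_space "distr M ?T ?n" by (rule prob_space_distr[OF n])
  have \<Phi>k: "\<Phi> k \<in> borel_measurable ?S" by (rule \<Phi>_meas) simp
  have Rk: "R k \<in> borel_measurable ?T" by (rule R_meas) simp
  have fst_meas: "(\<lambda>q. \<Phi> k (fst q)) \<in> borel_measurable (?S \<Otimes>\<^sub>M ?T)"
    by (rule measurable_compose[OF measurable_fst \<Phi>k])
  have snd_meas: "(\<lambda>q. R k (snd q)) \<in> borel_measurable (?S \<Otimes>\<^sub>M ?T)"
    by (rule measurable_compose[OF measurable_snd Rk])
  have F: "(\<lambda>q. f (\<Phi> k (fst q), R k (snd q))) \<in> borel_measurable (?S \<Otimes>\<^sub>M ?T)"
    by (rule measurable_compose[OF measurable_Pair[OF fst_meas snd_meas] f])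
  have inner_meas: "(\<lambda>h. f (\<Phi> k (?p \<omega>), R k h)) \<in> borel_measurable ?T" for \<omega>
    by (rule measurable_compose[OF measurable_Pair[OF measurable_const Rk] f]) simp
  have "(\<integral>\<^sup>+\<omega>. f (x k \<omega>, A k \<omega>) \<partial>M) = (\<integral>\<^sup>+\<omega>. f (\<Phi> k (?p \<omega>), R k (?n \<omega>)) \<partial>M)"
    using \<Phi>_past[of k] R_past[of k ?now] by (simp add: x_def)
  also have "\<dots> = (\<integral>\<^sup>+q. f (\<Phi> k (fst q), R k (snd q)) \<partial>distr M (?S \<Otimes>\<^sub>M ?T) (\<lambda>\<omega>. (?p \<omega>, ?n \<omega>)))"
    by (subst nn_integral_distr[unfolded measurable_distr_eq1, OF measurable_Pair[OF p n] F]) simp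
  also have "\<dots> = (\<integral>\<^sup>+h. \<integral>\<^sup>+h'. f (\<Phi> k h, R k h') \<partial>distr M ?T ?n \<partial>distr M ?S ?p)"
    unfolding prod using F by (subst n.nn_integral_fst[symmetric]) simp_all
  also have "\<dots> = (\<integral>\<^sup>+\<omega>. \<integral>\<^sup>+h'. f (\<Phi> k (?p \<omega>), R k h') \<partial>distr M ?T ?n \<partial>M)"
    by (rule nn_integral_distr[unfolded measurable_distr_eq1, OF p])
      (use n.borel_measurable_nn_integral_fst[of "\<lambda>q. f (\<Phi> k (fst q), R k (snd q))" ?S] F in simp)
  also have "\<dots> = (\<integral>\<^sup>+\<omega>. \<integral>\<^sup>+\<omega>'. f (\<Phi> k (?p \<omega>), R k (?n \<omega>')) \<partial>M \<partial>M)"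
    by (simp add: nn_integral_distr[unfolded measurable_distr_eq1, OF n inner_meas])
  also have "\<dots> = (\<integral>\<^sup>+\<omega>. \<integral>\<^sup>+\<omega>'. f (x k \<omega>, A k \<omega>') \<partial>M \<partial>M)"
    using \<Phi>_past[of k] R_past[of k ?now] by (simp add: x_def)
  finally show ?thesis .
qed

text \<open>The form \<open>x\<^sup>T P x\<close> is a cost-to-go: if the expected stage cost of a feedback, plus \<open>|x|\<^sup>2\<close>, never
  exceeds it, then summing over time bounds the total cost.\<close>

lemma feedback_cost_le:
  fixes B :: "real^'m^'n" and g :: "real^'n^'n \<Rightarrow> real^'n^'m" and P :: "real^'n^'n"
  assumes g: "g \<in> borel_measurable borel" and P: "pos_semidef P"
    and step: "\<And>k x. x \<bullet> x + (\<integral>\<^sup>+\<omega>. ennreal (stage_cost P B (A k \<omega> *v x) (g (A k \<omega>) *v x)) \<partial>M)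
        \<le> ennreal (x \<bullet> (P *v x))"
  shows "cost M A B x0 (feedback_input A B (\<lambda>k \<omega>. g (A k \<omega>)) x0) \<le> ennreal (x0 \<bullet> (P *v x0))"
proof -
  let ?x = "feedback_state A B (\<lambda>k \<omega>. g (A k \<omega>)) x0"
  let ?u = "feedback_input A B (\<lambda>k \<omega>. g (A k \<omega>)) x0"
  define V where "V k = (\<integral>\<^sup>+\<omega>. ennreal (?x k \<omega> \<bullet> (P *v ?x k \<omega>)) \<partial>M)" for k
  define h where "h = (\<lambda>p :: (real^'n) \<times> (real^'n^'n). stage_cost P B (snd p *v fst p) (g (snd p) *v fst p))"
  have P0: "0 \<le> y \<bullet> (P *v y)" for y using P by (simp add: pos_semidef_def)
  have x_meas [measurable]: "?x k \<in> borel_measurable M" for k by (rule state_measurable[OF g])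
  have u_meas [measurable]: "?u k \<in> borel_measurable M" for k
    unfolding feedback_input_def[abs_def]
    by (intro measurable_matrix_vector_mult x_meas measurable_compose[OF measurable_A g])
  have h_meas: "h \<in> borel_measurable (borel \<Otimes>\<^sub>M borel)"
    unfolding h_def stage_cost_def
    by (intro borel_measurable_add borel_measurable_inner measurable_matrix_vector_mult
        measurable_const measurable_fst measurable_snd measurable_compose[OF measurable_snd g]) simp_all
  \<comment> \<open>\<open>V k\<close> is the expected cost-to-go at time \<open>k\<close>; it pays for the costs incurred at time \<open>k\<close>.\<close>
  have one_step: "(\<integral>\<^sup>+\<omega>. ennreal (?x k \<omega> \<bullet> ?x k \<omega> + ?u k \<omega> \<bullet> ?u k \<omega>) \<partial>M) + V (Suc k) \<le> V k" for k
  proof -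
    have "(\<integral>\<^sup>+\<omega>. ennreal (?x k \<omega> \<bullet> ?x k \<omega> + ?u k \<omega> \<bullet> ?u k \<omega>) \<partial>M) + V (Suc k) =
        (\<integral>\<^sup>+\<omega>. ennreal (?x k \<omega> \<bullet> ?x k \<omega> + ?u k \<omega> \<bullet> ?u k \<omega>) +
            ennreal (?x (Suc k) \<omega> \<bullet> (P *v ?x (Suc k) \<omega>)) \<partial>M)"
      unfolding V_def
      by (intro nn_integral_add[symmetric] measurable_compose[OF _ measurable_ennreal]
          borel_measurable_add borel_measurable_inner measurable_matrix_vector_mult measurable_const
          x_meas u_meas) simp_all
    also have "\<dots> = (\<integral>\<^sup>+\<omega>. ennreal (?x k \<omega> \<bullet> ?x k \<omega>) + ennreal (h (?x k \<omega>, A k \<omega>)) \<partial>M)"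
      by (intro nn_integral_cong)
        (simp add: ennreal_plus[symmetric] P0 h_def stage_cost_def feedback_input_def add.assoc del: ennreal_plus)
    also have "\<dots> = (\<integral>\<^sup>+\<omega>. \<integral>\<^sup>+\<omega>'. ennreal (?x k \<omega> \<bullet> ?x k \<omega>) + ennreal (h (?x k \<omega>, A k \<omega>')) \<partial>M \<partial>M)"
      using nn_integral_state_dynamics[OF g, of "\<lambda>p. ennreal (fst p \<bullet> fst p) + ennreal (h p)" B x0 k] h_meas
      by simp
    also have "\<dots> \<le> V k"
      unfolding V_def
    proof (rule nn_integral_mono)
      fix \<omega>
      have "(\<lambda>\<omega>'. h (?x k \<omega>, A k \<omega>')) \<in> borel_measurable M"
        by (rule measurable_compose[OF _ h_meas]) simp
      then have "(\<integral>\<^sup>+\<omega>'. ennreal (?x k \<omega> \<bullet> ?x k \<omega>) + ennreal (h (?x k \<omega>, A k \<omega>')) \<partial>M) =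
          ennreal (?x k \<omega> \<bullet> ?x k \<omega>) + (\<integral>\<^sup>+\<omega>'. ennreal (h (?x k \<omega>, A k \<omega>')) \<partial>M)"
        by (subst nn_integral_add) (auto simp: emeasure_space_1)
      also have "\<dots> \<le> ennreal (?x k \<omega> \<bullet> (P *v ?x k \<omega>))"
        using step[of "?x k \<omega>" k] by (simp add: h_def)
      finally show "(\<integral>\<^sup>+\<omega>'. ennreal (?x k \<omega> \<bullet> ?x k \<omega>) + ennreal (h (?x k \<omega>, A k \<omega>')) \<partial>M)
        \<le> ennreal (?x k \<omega> \<bullet> (P *v ?x k \<omega>))" .
    qed
    finally show ?thesis .
  qed
  have total: "(\<integral>\<^sup>+\<omega>. ennreal (\<Sum>k<T. ?x k \<omega> \<bullet> ?x k \<omega> + ?u k \<omega> \<bullet> ?u k \<omega>) \<partial>M) + V T \<le> V 0" for T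
  proof (induction T)
    case (Suc T)
    have "(\<integral>\<^sup>+\<omega>. ennreal (\<Sum>k<Suc T. ?x k \<omega> \<bullet> ?x k \<omega> + ?u k \<omega> \<bullet> ?u k \<omega>) \<partial>M) =
      (\<integral>\<^sup>+\<omega>. ennreal (\<Sum>k<T. ?x k \<omega> \<bullet> ?x k \<omega> + ?u k \<omega> \<bullet> ?u k \<omega>)
         + ennreal (?x T \<omega> \<bullet> ?x T \<omega> + ?u T \<omega> \<bullet> ?u T \<omega>) \<partial>M)"
      by (intro nn_integral_cong) (simp add: ennreal_plus[symmetric] sum_nonneg del: ennreal_plus)
    also have "\<dots> = (\<integral>\<^sup>+\<omega>. ennreal (\<Sum>k<T. ?x k \<omega> \<bullet> ?x k \<omega> + ?u k \<omega> \<bullet> ?u k \<omega>) \<partial>M)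
         + (\<integral>\<^sup>+\<omega>. ennreal (?x T \<omega> \<bullet> ?x T \<omega> + ?u T \<omega> \<bullet> ?u T \<omega>) \<partial>M)"
      by (intro nn_integral_add measurable_compose[OF _ measurable_ennreal] borel_measurable_sum
          borel_measurable_add borel_measurable_inner x_meas u_meas)
    finally show ?case
      using add_left_mono[OF one_step[of T]] Suc by (metis (no_types, lifting) add.assoc order_trans)
  qed (simp add: V_def)
  have "(\<integral>\<^sup>+\<omega>. ennreal (\<Sum>k<T. ?x k \<omega> \<bullet> ?x k \<omega> + ?u k \<omega> \<bullet> ?u k \<omega>) \<partial>M) \<le> V 0" for T
    using total[of T] by (meson le_iff_add order_trans)
  moreover have "V 0 = ennreal (x0 \<bullet> (P *v x0))" by (simp add: V_def emeasure_space_1)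
  ultimately show ?thesis
    unfolding cost_eq_SUP state_feedback_input by (intro SUP_least) simp
qed

end

section \<open>The deadbeat controller\<close>

lemma sum_matrix_vector_mult:
  fixes X :: "'i \<Rightarrow> real^'a^'b"
  shows "(\<Sum>i\<in>I. X i) *v x = (\<Sum>i\<in>I. X i *v x)"
  by (induction I rule: infinite_finite_induct) (simp_all add: matrix_vector_mult_add_rdistrib)

lemma minus_matrix_vector_mult: "(- X) *v x = - (X *v x)" for X :: "real^'a^'b"
  using matrix_vector_mult_diff_rdistrib[of 0 X x] by simp

lemma block_col_mult_vec: "block_col ublk i B *v w = B *v block_vec ublk i w"
  by (auto simp: vec_eq_iff block_col_def matrix_vector_mult_def intro!: sum.cong)

text \<open>By the first-order condition, the gain for the \<open>i\<close>-th block column takes its values in the range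
  of the transpose of that column, so only inputs of subsystem \<open>i\<close> are used.\<close>

lemma gain_block_col_support:
  fixes B :: "real^'m^'n"
  assumes "pos_semidef P"
  shows "block_vec ublk i (gain P (block_col ublk i B) *v y) = gain P (block_col ublk i B) *v y"
proof -
  let ?K = "gain P (block_col ublk i B) *v y"
  obtain p where "?K = transpose (block_col ublk i B) *v p"
    using gain_stationary[OF assms, of "block_col ublk i B" y] by (metis add.inverse_unique minus_minus)
  then have "?K $ b = 0" if "ublk b \<noteq> i" for b
    using that
    by (simp add: matrix_vector_mult_def transpose_def block_col_def
        del: transpose_matrix_vector vector_transpose_matrix)
  then show ?thesis by (simp add: vec_eq_iff)
qed

lemma linear_form_bound:
  fixes W :: "real^'n^'n"
  obtains c where "1 \<le> c" "\<And>x. x \<bullet> (W *v x) \<le> c * (x \<bullet> x)"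
proof -
  obtain K where K: "\<And>x. norm (W *v x) \<le> norm x * K"
    using bounded_linear.bounded[OF matrix_vector_mul_bounded_linear[of W]] by blast
  have "x \<bullet> (W *v x) \<le> max 1 K * (x \<bullet> x)" for x
  proof -
    have "x \<bullet> (W *v x) \<le> norm x * norm (W *v x)" by (rule norm_cauchy_schwarz)
    also have "\<dots> \<le> norm x * (norm x * K)" by (intro mult_left_mono K) simp
    also have "\<dots> = K * (x \<bullet> x)" by (simp add: power2_norm_eq_inner[symmetric] power2_eq_square)
    also have "\<dots> \<le> max 1 K * (x \<bullet> x)" by (intro mult_right_mono) auto
    finally show ?thesis .
  qed
  then show thesis using that[of "max 1 K"] by simp
qed

context block_system
begin

text \<open>The cost of the deadbeat controller \<open>u(k) = - D A(k) x(k)\<close> from the initial state \<open>x\<close>, where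
  \<open>D\<close> stands for a right inverse of the input matrix.\<close>

definition deadbeat_cost :: "real^'n^'m \<Rightarrow> real^'n \<Rightarrow> real" where
  "deadbeat_cost D x = x \<bullet> x + (\<integral>\<omega>. (D *v (A 0 \<omega> *v x)) \<bullet> (D *v (A 0 \<omega> *v x)) \<partial>M)"

lemma deadbeat_moment:
  fixes D :: "real^'n^'m"
  shows "integrable M (\<lambda>\<omega>. (D *v (A k \<omega> *v x)) \<bullet> (D *v (A k \<omega> *v x)))" (is ?int)
    and "(\<integral>\<omega>. (D *v (A k \<omega> *v x)) \<bullet> (D *v (A k \<omega> *v x)) \<partial>M) = (D *v (Abar *v x)) \<bullet> (D *v (Abar *v x)) +
      (\<Sum>i\<in>UNIV. \<integral>\<omega>. (D *v (At i k \<omega> *v x)) \<bullet> (D *v (At i k \<omega> *v x)) \<partial>M)" (is ?eq)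
proof -
  have "D *v (A k \<omega> *v x) = D *v (Abar *v x) + (\<Sum>i\<in>UNIV. D *v (At i k \<omega> *v x))" for \<omega>
    by (simp add: A_eq_mean_plus_Atilde[of k] matrix_vector_mult_add_rdistrib matrix_vector_right_distrib
        sum_matrix_vector_mult linear_sum[OF matrix_vector_mul_linear])
  then show ?int ?eq
    using second_moment_decouples[where ?L0.0 = D and L = "\<lambda>_. D" and W = "mat 1" and y = "Abar *v x" and x = x and k = k]
    by simp_all
qed

lemma inner_self_le_deadbeat_cost: "x \<bullet> x \<le> deadbeat_cost D x"
  by (simp add: deadbeat_cost_def)

text \<open>The costs incurred at times 0 and 1 suffice for this lower bound on the cost of an arbitrary
  input process; neither causality nor measurability of \<open>u\<close> is needed.\<close>

lemma deadbeat_cost_le_cost: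
  fixes B :: "real^'m^'n" and D :: "real^'n^'m"
  assumes DB: "D ** B = mat 1" and "0 < \<epsilon>" and D: "\<And>z. \<epsilon> * norm (D *v z) \<le> norm z"
  shows "ennreal (deadbeat_cost D x0) \<le> ennreal (1 + 1/\<epsilon>\<^sup>2) * cost M A B x0 u"
proof -
  define c where "c = 1 + 1/\<epsilon>\<^sup>2"
  let ?d = "\<lambda>\<omega>. x0 \<bullet> x0 + (D *v (A 0 \<omega> *v x0)) \<bullet> (D *v (A 0 \<omega> *v x0))"
  have c: "1 \<le> c" by (simp add: c_def)
  have "deadbeat_cost D x0 / c = (\<integral>\<omega>. ?d \<omega> / c \<partial>M)"
    unfolding deadbeat_cost_def using deadbeat_moment(1)[of D 0 x0] by (simp add: prob_space)
  \<comment> \<open>The constant stays on this side: the integrand of the other side need not be measurable.\<close>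
  then have "ennreal (deadbeat_cost D x0 / c) = (\<integral>\<^sup>+\<omega>. ennreal (?d \<omega> / c) \<partial>M)"
    using deadbeat_moment(1)[of D 0 x0] c by (subst nn_integral_eq_integral) (auto intro!: divide_nonneg_nonneg)
  also have "\<dots> \<le> (\<integral>\<^sup>+\<omega>. ennreal (\<Sum>k<2. state A B x0 u k \<omega> \<bullet> state A B x0 u k \<omega> + u k \<omega> \<bullet> u k \<omega>) \<partial>M)"
  proof (intro nn_integral_mono ennreal_leI)
    fix \<omega>
    let ?x1 = "A 0 \<omega> *v x0 + B *v u 0 \<omega>"
    have "?d \<omega> \<le> c * (x0 \<bullet> x0) + c * (u 0 \<omega> \<bullet> u 0 \<omega> + ?x1 \<bullet> ?x1)"
      using inverse_input_bound[OF DB \<open>0 < \<epsilon>\<close> D, of "A 0 \<omega> *v x0" "u 0 \<omega>"]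
        mult_right_mono[OF c inner_ge_zero[of x0]] unfolding c_def by simp
    then have "?d \<omega> / c \<le> x0 \<bullet> x0 + (u 0 \<omega> \<bullet> u 0 \<omega> + ?x1 \<bullet> ?x1)"
      using c by (simp add: pos_divide_le_eq algebra_simps)
    moreover have "(\<Sum>k<2. state A B x0 u k \<omega> \<bullet> state A B x0 u k \<omega> + u k \<omega> \<bullet> u k \<omega>) =
        x0 \<bullet> x0 + u 0 \<omega> \<bullet> u 0 \<omega> + (?x1 \<bullet> ?x1 + u 1 \<omega> \<bullet> u 1 \<omega>)"
      by (simp add: numeral_2_eq_2)
    ultimately show "?d \<omega> / c \<le> (\<Sum>k<2. state A B x0 u k \<omega> \<bullet> state A B x0 u k \<omega> + u k \<omega> \<bullet> u k \<omega>)"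
      using inner_ge_zero[of "u 1 \<omega>"] by linarith
  qed
  also have "\<dots> \<le> cost M A B x0 u" by (rule partial_cost_le_cost)
  finally have "ennreal c * ennreal (deadbeat_cost D x0 / c) \<le> ennreal c * cost M A B x0 u"
    by (rule mult_left_mono) simp
  moreover have "ennreal c * ennreal (deadbeat_cost D x0 / c) = ennreal (deadbeat_cost D x0)"
    using c by (subst ennreal_mult'[symmetric]) auto
  ultimately show ?thesis by (simp add: c_def)
qed

lemma performance_ratio_le:
  fixes B :: "real^'m^'n" and D :: "real^'n^'m"
  assumes DB: "D ** B = mat 1" and \<epsilon>: "0 < \<epsilon>" and D: "\<And>z. \<epsilon> * norm (D *v z) \<le> norm z"
    and u: "\<And>x0. cost M A B x0 (u x0) \<le> ennreal (deadbeat_cost D x0)"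
    and v: "\<And>x0. cost M A B x0 (v x0) < \<infinity>"
  shows "performance_ratio M A B u v \<le> ennreal (1 + 1/\<epsilon>\<^sup>2)"
  unfolding performance_ratio_def
proof (rule SUP_least)
  fix x0 :: "real^'n" assume "x0 \<in> {x0. x0 \<noteq> 0}"
  then have "0 < x0 \<bullet> x0" by simp
  then have "0 < deadbeat_cost D x0" using inner_self_le_deadbeat_cost[of x0 D] by (rule less_le_trans)
  note low = deadbeat_cost_le_cost[OF DB \<epsilon> D, of x0 "v x0"]
  have "cost M A B x0 (v x0) \<noteq> 0"
    using low \<open>0 < deadbeat_cost D x0\<close> by (auto simp: ennreal_eq_0_iff)
  moreover have "cost M A B x0 (u x0) \<le> ennreal (1 + 1/\<epsilon>\<^sup>2) * cost M A B x0 (v x0)"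
    using u[of x0] low by (rule order_trans)
  ultimately have "cost M A B x0 (u x0) / cost M A B x0 (v x0) \<le> ennreal (1 + 1/\<epsilon>\<^sup>2)"
    using v[of x0] by (intro divide_le_posI_ennreal) (auto simp: zero_less_iff_neq_zero mult.commute)
  then show "(if cost M A B x0 (v x0) = \<infinity> then \<infinity> else cost M A B x0 (u x0) / cost M A B x0 (v x0))
      \<le> ennreal (1 + 1/\<epsilon>\<^sup>2)"
    using v[of x0] by auto
qed

text \<open>The input process generated by the deadbeat feedback from a given initial state.\<close>

definition deadbeat_input :: "real^'m^'n \<Rightarrow> real^'n^'m \<Rightarrow> real^'n \<Rightarrow> nat \<Rightarrow> 'w \<Rightarrow> real^'m" where
  "deadbeat_input B D = feedback_input A B (\<lambda>k \<omega>. - (D ** A k \<omega>))"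

lemma deadbeat_input_eq:
  "deadbeat_input B D x0 k \<omega> = - (D *v (A k \<omega> *v state A B x0 (deadbeat_input B D x0) k \<omega>))"
  unfolding deadbeat_input_def state_feedback_input
  by (simp add: feedback_input_def minus_matrix_vector_mult matrix_vector_mul_assoc)

lemma cost_deadbeat_input:
  fixes B :: "real^'m^'n" and D :: "real^'n^'m"
  assumes BD: "B ** D = mat 1"
  shows "cost M A B x0 (deadbeat_input B D x0) \<le> ennreal (deadbeat_cost D x0)"
proof -
  let ?u = "deadbeat_input B D x0" and ?x = "state A B x0 (deadbeat_input B D x0)"
  have x_Suc: "?x (Suc k) \<omega> = 0" for k \<omega>
    using deadbeat_input_eq[of B D x0 k \<omega>]
    by (simp add: matrix_vector_mult_minus matrix_vector_mul_assoc matrix_mul_assoc BD)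
  then have u_Suc: "?u (Suc k) \<omega> = 0" for k \<omega> by (subst deadbeat_input_eq) (simp only: x_Suc, simp)
  have u_0: "?u 0 \<omega> = - (D *v (A 0 \<omega> *v x0))" for \<omega> by (subst deadbeat_input_eq) simp
  have "(\<Sum>k<T. ?x k \<omega> \<bullet> ?x k \<omega> + ?u k \<omega> \<bullet> ?u k \<omega>) \<le>
      x0 \<bullet> x0 + (D *v (A 0 \<omega> *v x0)) \<bullet> (D *v (A 0 \<omega> *v x0))" for T \<omega>
    by (cases T) (simp_all only: sum.lessThan_Suc_shift x_Suc u_Suc u_0, simp_all)
  then have "cost M A B x0 ?u \<le> (\<integral>\<^sup>+\<omega>. ennreal (x0 \<bullet> x0 + (D *v (A 0 \<omega> *v x0)) \<bullet> (D *v (A 0 \<omega> *v x0))) \<partial>M)"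
    unfolding cost_eq_SUP by (intro SUP_least nn_integral_mono ennreal_leI)
  also have "\<dots> = ennreal (deadbeat_cost D x0)"
    unfolding deadbeat_cost_def using deadbeat_moment(1)[of D 0 x0]
    by (subst nn_integral_eq_integral) (simp_all add: prob_space)
  finally show ?thesis .
qed

lemma measurable_deadbeat_law:
  fixes D :: "real^'n^'m" and k :: nat
  shows "(\<lambda>(Z, h). - (D *v (Z *v h k))) \<in> borel \<Otimes>\<^sub>M (\<Pi>\<^sub>M j\<in>{..k}. borel) \<rightarrow>\<^sub>M borel"
proof -
  have "(\<lambda>p :: (real^'n^'n) \<times> (nat \<Rightarrow> real^'n). snd p k) \<in> borel \<Otimes>\<^sub>M (\<Pi>\<^sub>M j\<in>{..k}. borel) \<rightarrow>\<^sub>M borel"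
    by (rule measurable_compose[OF measurable_snd measurable_component_singleton]) simp
  then show ?thesis
    unfolding case_prod_unfold
    by (intro borel_measurable_uminus measurable_matrix_vector_mult measurable_const measurable_fst) simp_all
qed

lemma deadbeat_full_info: "full_info M A B x0 (deadbeat_input B D x0)"
  unfolding full_info_def
proof (rule exI[of _ "\<lambda>k (Z, h). - (D *v (Z *v h k))"], intro conjI allI ballI)
  fix k \<omega>
  show "deadbeat_input B D x0 k \<omega> = (case (A k \<omega>, \<lambda>j\<in>{..k}. state A B x0 (deadbeat_input B D x0) j \<omega>)
      of (Z, h) \<Rightarrow> - (D *v (Z *v h k)))"
    by (subst deadbeat_input_eq) simp
qed (rule measurable_deadbeat_law)

lemma deadbeat_limited_info:
  fixes D :: "real^'n^'m"
  assumes D: "block_diagonal ublk blk D"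
  shows "limited_info M blk ublk A B x0 (deadbeat_input B D x0)"
  unfolding limited_info_def
proof (rule exI[of _ "\<lambda>i k (Z, h). - (D *v (Z *v h k))"], intro conjI allI ballI)
  fix k \<omega> b
  let ?x = "state A B x0 (deadbeat_input B D x0)"
  have "(D *v (block_row blk (ublk b) (A k \<omega>) *v y)) $ b = (D *v (A k \<omega> *v y)) $ b" for y
    by (simp add: block_row_mult_vec block_diagonal_mult_block_vec[OF D])
  then show "deadbeat_input B D x0 k \<omega> $ b =
      (case (block_row blk (ublk b) (A k \<omega>), \<lambda>j\<in>{..k}. ?x j \<omega>) of (Z, h) \<Rightarrow> - (D *v (Z *v h k))) $ b"
    by (subst deadbeat_input_eq) simp
qed (rule measurable_deadbeat_law)

end

section \<open>The Riccati equations and the feedbacks they define\<close>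

text \<open>The two Riccati equations differ only in the input matrix that may react to the
  fluctuation of block row \<open>i\<close>; it is called \<open>Bf i\<close>, which is the \<open>i\<close>-th block column of \<open>B\<close> for limited and
  \<open>B\<close> itself for full model information. Each \<open>Bf i\<close> can cancel a disturbance of block \<open>i\<close> by means of
  \<open>D\<close>, and agrees with \<open>B\<close> on the inputs that its gain produces.\<close>

locale feedback_design = block_system M blk A Abar \<Sigma>
  for M :: "'w measure" and blk :: "'n::finite \<Rightarrow> 's::finite"
    and A :: "nat \<Rightarrow> 'w \<Rightarrow> real^'n^'n" and Abar and \<Sigma> +
  fixes B :: "real^'m^'n" and D :: "real^'n^'m" and Bf :: "'s \<Rightarrow> real^'m^'n"
  assumes BD: "B ** D = mat 1"
    and Bf_cancel: "\<And>i v. Bf i *v (D *v block_vec blk i v) = block_vec blk i v"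
    and Bf_gain: "\<And>i P y. pos_semidef P \<Longrightarrow> B *v (gain P (Bf i) *v y) = Bf i *v (gain P (Bf i) *v y)"
begin

text \<open>The right-hand side of the Riccati equation, with the expectations taken at time \<open>k\<close>. It does
  not depend on \<open>k\<close>, because the first two moments do not.\<close>

definition riccati_rhs :: "nat \<Rightarrow> real^'n^'n \<Rightarrow> real^'n^'n" where
  "riccati_rhs k P = mat 1 + riccati Abar P B (mat 1) +
     (\<Sum>i\<in>UNIV. \<integral>\<omega>. riccati (At i k \<omega>) P (Bf i) (mat 1) \<partial>M)"

lemma riccati_rhs_indep_time: "riccati_rhs k P = riccati_rhs k' P"
  unfolding riccati_rhs_def
  by (intro arg_cong2[where f = "(+)"] refl sum.cong riccati_Atilde_integral_indep_time)

lemma riccati_rhs_form: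
  "x \<bullet> (riccati_rhs k P *v x) = x \<bullet> x + (Abar *v x) \<bullet> (riccati_form P B *v (Abar *v x)) +
    (\<Sum>i\<in>UNIV. \<integral>\<omega>. (At i k \<omega> *v x) \<bullet> (riccati_form P (Bf i) *v (At i k \<omega> *v x)) \<partial>M)"
  unfolding riccati_rhs_def
  by (simp add: matrix_vector_mult_add_rdistrib inner_add_right sum_matrix_vector_mult inner_sum_right
      riccati_Atilde_integral_form) (simp add: riccati_eq congruence_form)

lemma riccati_rhs_symmetric:
  assumes "pos_semidef P"
  shows "transpose (riccati_rhs k P) = riccati_rhs k P"
proof -
  have "transpose (\<Sum>i\<in>UNIV. \<integral>\<omega>. riccati (At i k \<omega>) P (Bf i) (mat 1) \<partial>M) =
      (\<Sum>i\<in>UNIV. transpose (\<integral>\<omega>. riccati (At i k \<omega>) P (Bf i) (mat 1) \<partial>M))"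
    by (simp add: vec_eq_iff transpose_def)
  then show ?thesis
    by (simp add: riccati_rhs_def transpose_add riccati_Atilde_integral_symmetric[OF assms])
      (simp add: riccati_eq matrix_transpose_mul riccati_form_symmetric[OF assms] matrix_mul_assoc)
qed

lemma riccati_rhs_scaled_mono:
  assumes P: "pos_semidef P" and Q: "pos_semidef Q" and t: "t \<le> 1"
    and le: "\<And>x. t * (x \<bullet> (P *v x)) \<le> x \<bullet> (Q *v x)"
  shows "t * (x \<bullet> (riccati_rhs k P *v x)) + (1 - t) * (x \<bullet> x) \<le> x \<bullet> (riccati_rhs k Q *v x)"
proof -
  note mono = riccati_form_mono[OF P Q le t]
  have "t * (\<Sum>i\<in>UNIV. \<integral>\<omega>. (At i k \<omega> *v x) \<bullet> (riccati_form P (Bf i) *v (At i k \<omega> *v x)) \<partial>M)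
      \<le> (\<Sum>i\<in>UNIV. \<integral>\<omega>. (At i k \<omega> *v x) \<bullet> (riccati_form Q (Bf i) *v (At i k \<omega> *v x)) \<partial>M)"
    unfolding sum_distrib_left integral_mult_right_zero[symmetric]
    by (intro sum_mono integral_mono integrable_mult_right bilinear_form_Atilde_integrable mono)
  then show ?thesis
    using mono[of "Abar *v x" B] unfolding riccati_rhs_form by (simp add: algebra_simps)
qed

text \<open>The deadbeat input \<open>- D y\<close> leaves no cost-to-go, so the minimum over all inputs is at most
  \<open>|D y|\<^sup>2\<close>.\<close>

lemma riccati_rhs_le_deadbeat_cost:
  assumes P: "pos_semidef P"
  shows "x \<bullet> (riccati_rhs 0 P *v x) \<le> deadbeat_cost D x"
proof -
  have le: "y \<bullet> (riccati_form P C *v y) \<le> (D *v y) \<bullet> (D *v y)" if "C *v (D *v y) = y" for C y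
    using riccati_form_le_stage_cost[OF P, of y C "- (D *v y)"] that
    by (simp add: stage_cost_def matrix_vector_mult_minus)
  have "Bf i *v (D *v (At i 0 \<omega> *v x)) = At i 0 \<omega> *v x" for i \<omega>
    unfolding Atilde_def block_row_mult_vec by (rule Bf_cancel)
  note Bf_le = le[OF this]
  have "(\<Sum>i\<in>UNIV. \<integral>\<omega>. (At i 0 \<omega> *v x) \<bullet> (riccati_form P (Bf i) *v (At i 0 \<omega> *v x)) \<partial>M) \<le>
      (\<Sum>i\<in>UNIV. \<integral>\<omega>. (D *v (At i 0 \<omega> *v x)) \<bullet> (D *v (At i 0 \<omega> *v x)) \<partial>M)"
  proof (intro sum_mono integral_mono bilinear_form_Atilde_integrable Bf_le)
    fix i
    have "(D *v v) \<bullet> (D *v v) = v \<bullet> ((transpose D ** D) *v v)" for v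
      by (simp add: matrix_vector_mul_assoc[symmetric] inner_matrix_vector
          del: transpose_matrix_vector vector_transpose_matrix)
    then show "integrable M (\<lambda>\<omega>. (D *v (At i 0 \<omega> *v x)) \<bullet> (D *v (At i 0 \<omega> *v x)))"
      by (simp only: bilinear_form_Atilde_integrable)
  qed
  moreover have "(Abar *v x) \<bullet> (riccati_form P B *v (Abar *v x)) \<le> (D *v (Abar *v x)) \<bullet> (D *v (Abar *v x))"
    by (rule le) (simp add: matrix_vector_mul_assoc matrix_mul_assoc BD)
  ultimately show ?thesis
    unfolding riccati_rhs_form deadbeat_cost_def deadbeat_moment(2) by linarith
qed

lemma ex1_riccati_solution: "\<exists>!P. pos_def P \<and> P = riccati_rhs 0 P"
proof -
  let ?W = "mat 1 + (\<integral>\<omega>. transpose (A 0 \<omega>) ** (transpose D ** D) ** A 0 \<omega> \<partial>M)"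
  have int: "integrable M (\<lambda>\<omega>. transpose (A 0 \<omega>) ** (transpose D ** D) ** A 0 \<omega>)"
    by (intro integrable_matrixI) (simp only: congruence_entry, intro Bochner_Integration.integrable_sum
      integrable_mult_right entry_product_integrable)
  have "deadbeat_cost D x = x \<bullet> (?W *v x)" for x
    unfolding matrix_vector_mult_add_rdistrib inner_add_right integral_matrix_form[OF int] congruence_form
    by (simp add: deadbeat_cost_def matrix_vector_mul_assoc[symmetric] inner_matrix_vector
        del: transpose_matrix_vector vector_transpose_matrix)
  moreover obtain c where "1 \<le> c" "\<And>x. x \<bullet> (?W *v x) \<le> c * (x \<bullet> x)"
    using linear_form_bound[of ?W] by blast
  ultimately have c: "1 \<le> c" "\<And>x. deadbeat_cost D x \<le> c * (x \<bullet> x)" by simp_all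
  show ?thesis
    by (rule ex1_pos_def_fixed_point[OF riccati_rhs_symmetric riccati_rhs_scaled_mono _ c(1)])
      (use riccati_rhs_le_deadbeat_cost c(2) order_trans in blast)+
qed

text \<open>The positive definite solution of the Riccati equation; the description is proper by
  \<open>ex1_riccati_solution\<close>.\<close>

definition riccati_solution :: "real^'n^'n" where
  "riccati_solution = (THE P. pos_def P \<and>
     (\<forall>k. P = mat 1 + riccati Abar P B (mat 1) +
        (\<Sum>i\<in>UNIV. \<integral>\<omega>. riccati (At i k \<omega>) P (Bf i) (mat 1) \<partial>M)))"

lemma riccati_solution:
  "pos_semidef riccati_solution" "riccati_solution = riccati_rhs k riccati_solution"
proof -
  have "riccati_solution = (THE P. pos_def P \<and> P = riccati_rhs 0 P)"
    unfolding riccati_solution_def riccati_rhs_def[symmetric]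
    using riccati_rhs_indep_time by metis
  then have "pos_def riccati_solution \<and> riccati_solution = riccati_rhs 0 riccati_solution"
    using theI'[OF ex1_riccati_solution] by simp
  then show "pos_semidef riccati_solution" "riccati_solution = riccati_rhs k riccati_solution"
    using riccati_rhs_indep_time[of k _ 0] by (auto intro: pos_def_imp_pos_semidef)
qed

text \<open>The feedback gain as a function of the current system matrix: one gain acts on the mean of the
  dynamics and one on the fluctuation of each block row.\<close>

definition feedback_gain :: "real^'n^'n \<Rightarrow> real^'n^'m" where
  "feedback_gain Z = - (gain riccati_solution B ** Abar)
     - (\<Sum>i\<in>UNIV. gain riccati_solution (Bf i) ** block_row blk i (Z - Abar))"

lemma measurable_feedback_gain: "feedback_gain \<in> borel_measurable borel"
  unfolding feedback_gain_def[abs_def]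
  by (intro borel_measurable_diff borel_measurable_sum measurable_matrix_mult measurable_block_row
      measurable_const measurable_ident_sets refl) simp_all

text \<open>The feedback attains the value of the Riccati equation: both the input and the successor state are
  a deterministic vector plus a sum over the block rows, so that their second moments
  decouple into the separately minimized stage costs.\<close>

lemma feedback_gain_stage_cost:
  fixes x
  defines "P \<equiv> riccati_solution"
  defines "h \<equiv> \<lambda>k \<omega>. stage_cost P B (A k \<omega> *v x) (feedback_gain (A k \<omega>) *v x)"
  shows "integrable M (h k)" "x \<bullet> x + (\<integral>\<omega>. h k \<omega> \<partial>M) = x \<bullet> (P *v x)"
proof -
  let ?v = "\<lambda>i \<omega>. At i k \<omega> *v x" and ?y = "Abar *v x"
  let ?KB = "gain P B" and ?K = "\<lambda>i. gain P (Bf i)"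
  have psd: "pos_semidef P" and fp: "P = riccati_rhs k P"
    unfolding P_def by (rule riccati_solution)+
  define u where "u \<omega> = (- ?KB) *v ?y + (\<Sum>i\<in>UNIV. (- ?K i) *v ?v i \<omega>)" for \<omega>
  define w where "w \<omega> = (mat 1 - B ** ?KB) *v ?y + (\<Sum>i\<in>UNIV. (mat 1 - B ** ?K i) *v ?v i \<omega>)" for \<omega>
  have u: "feedback_gain (A k \<omega>) *v x = u \<omega>" for \<omega>
    by (simp add: feedback_gain_def u_def P_def Atilde_def mean_A minus_matrix_vector_mult
        matrix_vector_mult_diff_rdistrib sum_matrix_vector_mult matrix_vector_mul_assoc[symmetric] sum_negf)
  have w: "A k \<omega> *v x + B *v u \<omega> = w \<omega>" for \<omega>
    by (simp add: u_def w_def A_eq_mean_plus_Atilde[of k] matrix_vector_mult_add_rdistrib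
        matrix_vector_mult_diff_rdistrib sum_matrix_vector_mult matrix_vector_right_distrib
        minus_matrix_vector_mult matrix_vector_mult_minus linear_sum[OF matrix_vector_mul_linear]
        matrix_vector_mul_assoc[symmetric] sum.distrib sum_subtractf sum_negf algebra_simps)
  have h: "h k \<omega> = u \<omega> \<bullet> (mat 1 *v u \<omega>) + w \<omega> \<bullet> (P *v w \<omega>)" for \<omega>
    unfolding h_def stage_cost_def u w by simp
  note du = second_moment_decouples[where ?L0.0 = "- ?KB" and L = "\<lambda>i. - ?K i" and W = "mat 1"
      and y = ?y and x = x and k = k, folded u_def]
  note dw = second_moment_decouples[where ?L0.0 = "mat 1 - B ** ?KB" and L = "\<lambda>i. mat 1 - B ** ?K i"
      and W = P and y = ?y and x = x and k = k, folded w_def]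
  show "integrable M (h k)" unfolding h using du(1) dw(1) by (rule Bochner_Integration.integrable_add)
  have split: "((- gain P C) *v y) \<bullet> (mat 1 *v ((- gain P C) *v y)) +
      ((mat 1 - B ** gain P C) *v y) \<bullet> (P *v ((mat 1 - B ** gain P C) *v y)) =
      y \<bullet> (riccati_form P C *v y)" if "B *v (gain P C *v y) = C *v (gain P C *v y)" for C y
    using stage_cost_gain[OF psd, of C y] that
    by (simp add: stage_cost_def minus_matrix_vector_mult matrix_vector_mult_diff_rdistrib
        matrix_vector_mult_minus matrix_vector_mul_assoc[symmetric])
  have pair_int: "integrable M (\<lambda>\<omega>. (L *v ?v i \<omega>) \<bullet> (W *v (L *v ?v i \<omega>)))"
    for i and L :: "real^'n^'q::finite" and W
  proof -
    have "(L *v v) \<bullet> (W *v (L *v v)) = v \<bullet> ((transpose L ** W ** L) *v v)" for v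
      by (rule congruence_form[symmetric])
    then show ?thesis by (simp only: bilinear_form_Atilde_integrable)
  qed
  have "(\<integral>\<omega>. h k \<omega> \<partial>M) = ?y \<bullet> (riccati_form P B *v ?y) +
      (\<Sum>i\<in>UNIV. \<integral>\<omega>. ?v i \<omega> \<bullet> (riccati_form P (Bf i) *v ?v i \<omega>) \<partial>M)"
    unfolding h Bochner_Integration.integral_add[OF du(1) dw(1)] du(2) dw(2)
      split[OF Bf_gain[OF psd], symmetric] split[OF refl, symmetric]
    by (simp only: Bochner_Integration.integral_add[OF pair_int pair_int] sum.distrib add_ac)
  then show "x \<bullet> x + (\<integral>\<omega>. h k \<omega> \<partial>M) = x \<bullet> (P *v x)"
    using riccati_rhs_form[of x k P] fp by simp
qed

lemma feedback_gain_cost: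
  "cost M A B x0 (feedback_input A B (\<lambda>k \<omega>. feedback_gain (A k \<omega>)) x0)
    \<le> ennreal (x0 \<bullet> (riccati_solution *v x0))"
proof (rule feedback_cost_le[OF measurable_feedback_gain riccati_solution(1)])
  fix k x
  let ?h = "\<lambda>\<omega>. stage_cost riccati_solution B (A k \<omega> *v x) (feedback_gain (A k \<omega>) *v x)"
  have nn: "0 \<le> ?h \<omega>" for \<omega>
    using riccati_solution(1) by (simp add: stage_cost_def pos_semidef_def)
  have "(\<integral>\<^sup>+\<omega>. ennreal (?h \<omega>) \<partial>M) = ennreal (\<integral>\<omega>. ?h \<omega> \<partial>M)"
    by (rule nn_integral_eq_integral[OF feedback_gain_stage_cost(1)]) (simp add: nn)
  then show "ennreal (x \<bullet> x) + (\<integral>\<^sup>+\<omega>. ennreal (?h \<omega>) \<partial>M) \<le> ennreal (x \<bullet> (riccati_solution *v x))"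
    using feedback_gain_stage_cost(2)[of x k] nn
    by (simp add: ennreal_plus[symmetric] integral_nonneg_AE del: ennreal_plus)
qed

lemma riccati_solution_le_deadbeat_cost: "x \<bullet> (riccati_solution *v x) \<le> deadbeat_cost D x"
  using riccati_rhs_le_deadbeat_cost[OF riccati_solution(1)] riccati_solution(2)[of 0] by metis

end

section \<open>The performance degradation bound\<close>

theorem theorem6:
  fixes M :: "'w measure"
    and blk :: "'n::finite \<Rightarrow> 's::finite" and ublk :: "'m::finite \<Rightarrow> 's"
    and A :: "nat \<Rightarrow> 'w \<Rightarrow> real^'n^'n" and B :: "real^'m^'n"
    and Abar :: "real^'n^'n" and \<Sigma> :: "real^('n \<times> 'n)^('n \<times> 'n)" and \<epsilon> :: real
  assumes "prob_space M"
    and "surj blk" and "surj ublk"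
    and "prob_space.indep_vars M (\<lambda>_. borel)
           (\<lambda>(k, i) \<omega>. block_row blk i (A k \<omega>)) (UNIV :: (nat \<times> 's) set)"
    and "\<And>k. integrable M (A k)"
    and "\<And>k. integrable M (\<lambda>\<omega>. kronecker (A k \<omega>) (A k \<omega>))"
    and "\<And>k. integral\<^sup>L M (A k) = Abar"
    and "\<And>k. (\<integral>\<omega>. kronecker (A k \<omega>) (A k \<omega>) \<partial>M) = \<Sigma>"
    and "block_diagonal blk ublk B"
    and "\<And>i. card {b. ublk b = i} = card {a. blk a = i}"
    and "\<epsilon> > 0" and "\<And>i. min_block_singular_value blk ublk i B \<ge> \<epsilon>"
    and "stabilizable_limited_info M blk ublk A B"
  shows "performance_ratio M A B (u_LMI M blk ublk A Abar B) (u_FMI M blk A Abar B)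
           \<le> ennreal (1 + 1 / \<epsilon>\<^sup>2) \<and>
         (\<forall>uL uF. (\<forall>x0. optimal_limited_info M blk ublk A B x0 (uL x0)) \<longrightarrow>
                  (\<forall>x0. optimal_full_info M A B x0 (uF x0)) \<longrightarrow>
                  performance_ratio M A B uL uF \<le> ennreal (1 + 1 / \<epsilon>\<^sup>2))"
proof -
  interpret block_system M blk A Abar \<Sigma>
    using assms(1,4-8) by (simp add: block_system_def block_system_axioms_def)
  obtain D :: "real^'n^'m" where BD: "B ** D = mat 1" and DB: "D ** B = mat 1"
    and D: "\<And>z. \<epsilon> * norm (D *v z) \<le> norm z" and D_diag: "block_diagonal ublk blk D"
    by (rule block_diagonal_inverse[OF assms(9,10,11,12)]) blast
  have BDz: "B *v (D *v z) = z" for z by (simp add: matrix_vector_mul_assoc BD)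
  interpret L: feedback_design M blk A Abar \<Sigma> B D "\<lambda>i. block_col ublk i B"
  proof
    show "B ** D = mat 1" by (rule BD)
    show "block_col ublk i B *v (D *v block_vec blk i v) = block_vec blk i v" for i v
      by (simp add: block_diagonal_mult_block_vec[OF D_diag] block_diagonal_mult_block_vec[OF assms(9)]
          block_col_mult_vec BDz) (simp add: vec_eq_iff)
    show "B *v (gain P (block_col ublk i B) *v y) = block_col ublk i B *v (gain P (block_col ublk i B) *v y)"
      if "pos_semidef P" for i P y
      unfolding block_col_mult_vec gain_block_col_support[OF that] ..
  qed
  interpret F: feedback_design M blk A Abar \<Sigma> B D "\<lambda>_. B"
    by unfold_locales (simp_all add: BD BDz)
  have "gain_LMI M blk ublk A Abar B = (\<lambda>k \<omega>. L.feedback_gain (A k \<omega>))"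
  proof (intro ext)
    fix k \<omega>
    let ?P = "L.riccati_solution"
    let ?K = "\<lambda>i. gain ?P (block_col ublk i B) ** Atilde M blk A i k \<omega>"
    \<comment> \<open>Row \<open>b\<close> of the sum over the subsystems only receives the term of the subsystem that owns \<open>b\<close>.\<close>
    have row: "?K i $ b = 0" if "ublk b \<noteq> i" for i b
    proof -
      have "?K i $ b $ c = 0" for c
      proof -
        have "?K i $ b $ c = (gain ?P (block_col ublk i B) *v (Atilde M blk A i k \<omega> *v axis c 1)) $ b"
          by (simp add: matrix_matrix_mult_def matrix_vector_mult_def[of "gain _ _"]
              matrix_vector_mult_basis column_def)
        also have "\<dots> = 0"
          using gain_block_col_support[OF L.riccati_solution(1), of ublk i B] that
          by (metis block_vec_nth)
        finally show ?thesis .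
      qed
      then show ?thesis by (simp add: vec_eq_iff)
    qed
    have "(\<Sum>i\<in>UNIV. ?K i) $ b = ?K (ublk b) $ b" for b
    proof -
      have "(\<Sum>i\<in>UNIV. ?K i $ b) = (\<Sum>i\<in>UNIV. if i = ublk b then ?K i $ b else 0)"
        by (intro sum.cong refl) (use row in auto)
      then show ?thesis by simp
    qed
    then have "(\<Sum>i\<in>UNIV. ?K i) = (\<chi> b. ?K (ublk b) $ b)" by (simp add: vec_eq_iff)
    moreover have "P_LMI M blk ublk A Abar B = ?P"
      by (simp add: P_LMI_def L.riccati_solution_def)
    ultimately show "gain_LMI M blk ublk A Abar B k \<omega> = L.feedback_gain (A k \<omega>)"
      by (simp add: gain_LMI_def L.feedback_gain_def Let_def gain_def Atilde_def mean_A)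
  qed
  then have "cost M A B x0 (u_LMI M blk ublk A Abar B x0) \<le> ennreal (x0 \<bullet> (L.riccati_solution *v x0))" for x0
    using L.feedback_gain_cost by (simp add: u_LMI_def)
  then have LMI: "cost M A B x0 (u_LMI M blk ublk A Abar B x0) \<le> ennreal (deadbeat_cost D x0)" for x0
    using L.riccati_solution_le_deadbeat_cost ennreal_leI order_trans by blast
  have "gain_FMI M blk A Abar B = (\<lambda>k \<omega>. F.feedback_gain (A k \<omega>))"
  proof (intro ext)
    fix k \<omega>
    let ?K = "gain F.riccati_solution B"
    have "F.feedback_gain (A k \<omega>) = - (?K ** A k \<omega>)"
      unfolding matrix_eq F.feedback_gain_def
      by (simp add: matrix_vector_mult_diff_rdistrib minus_matrix_vector_mult sum_matrix_vector_mult
          matrix_vector_mul_assoc[symmetric] linear_sum[OF matrix_vector_mul_linear, symmetric])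
        (simp add: sum_matrix_vector_mult[symmetric] sum_block_row matrix_vector_mult_diff_rdistrib
          matrix_vector_mult_diff_distrib)
    moreover have "P_FMI M blk A Abar B = F.riccati_solution"
      by (simp add: P_FMI_def F.riccati_solution_def)
    ultimately show "gain_FMI M blk A Abar B k \<omega> = F.feedback_gain (A k \<omega>)"
      by (simp add: gain_FMI_def Let_def gain_def)
  qed
  then have "cost M A B x0 (u_FMI M blk A Abar B x0) \<le> ennreal (x0 \<bullet> (F.riccati_solution *v x0))" for x0
    using F.feedback_gain_cost by (simp add: u_FMI_def)
  then have FMI: "cost M A B x0 (u_FMI M blk A Abar B x0) < \<infinity>" for x0
    using le_less_trans ennreal_less_top unfolding infinity_ennreal_def by blast
  have deadbeat: "cost M A B x0 (deadbeat_input B D x0) \<le> ennreal (deadbeat_cost D x0)" for x0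
    by (rule cost_deadbeat_input[OF BD])
  have "performance_ratio M A B uL uF \<le> ennreal (1 + 1 / \<epsilon>\<^sup>2)"
    if uL: "\<And>x0. optimal_limited_info M blk ublk A B x0 (uL x0)"
      and uF: "\<And>x0. optimal_full_info M A B x0 (uF x0)" for uL uF
  proof (rule performance_ratio_le[OF DB \<open>\<epsilon> > 0\<close> D])
    fix x0
    show "cost M A B x0 (uL x0) \<le> ennreal (deadbeat_cost D x0)"
      using uL deadbeat_limited_info[OF D_diag] deadbeat
      unfolding optimal_limited_info_def by (meson order_trans)
    have "cost M A B x0 (uF x0) \<le> ennreal (deadbeat_cost D x0)"
      using uF deadbeat_full_info deadbeat
      unfolding optimal_full_info_def by (meson order_trans)
    then show "cost M A B x0 (uF x0) < \<infinity>"
      unfolding infinity_ennreal_def using ennreal_less_top by (rule le_less_trans)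
  qed
  moreover note performance_ratio_le[OF DB \<open>\<epsilon> > 0\<close> D LMI FMI]
  ultimately show ?thesis by blast
qed

end
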